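(* Let $n,k \geq 2$ be integers. Then the maximum number of edges in an ambiguously $k$-colorable graph on $n$ vertices is $$\mathrm{ex}(n,K_{k+1})-\max\left\{1,\left\lfloor \tfrac{n}{k} \right\rfloor\right\}.$$ Moreover, the ambiguously $k$-colorable graphs on $n$ vertices attaining this bound are, up to isomorphism, exactly the graphs $G(A)$ on $n$ vertices where $A$ is a desirable $k \times k$-matrix such that $A$ is tiny or small or very special or mininormal.
   Context: All graphs are finite and simple. An anticlique of a graph $G$ is a set of pairwise nonadjacent vertices of $G$. A $k$-coloring of $G$ is a partition of $V(G)$ (into nonempty classes) into at most $k$ anticliques. A graph is ambiguously $k$-colorable if it has at least two distinct $k$-colorings. $\mathrm{ex}(n,K_{k+1})$ denotes the largest number of edges of a simple graph on $n$ vertices without $K_{k+1}$ as a subgraph. For a $k\times k$-matrix $A$ with non-negative integer entries, $G(A)$ is the graph on vertex set $\{(i,j,t) : i,j \in \{1,\dots,k\},\ t \in \{1,\dots,A(i,j)\}\}$, where $(i,j,t)$ and $(i',j',t')$ are adjacent if and only if $i \neq i'$ and $j \neq j'$. The number of vertices of $G(A)$ is the sum of all entries of $A$; below, $n$ denotes this sum and $\alpha := \lfloor n/k \rfloor$. Let $A$ be a $k \times k$-matrix all of whose entries are non-negative integers. - $A$ is tiny if it is a diagonal matrix with exactly one (diagonal) entry equal to $2$, all other entries at most $1$, and at least two diagonal entries equal to $0$. - $A$ is small if it is a diagonal matrix with at least one entry equal to $2$, all others at most $2$, and exactly one diagonal entry equal to $0$. - $A$ is special if all diagonal entries are nonzero,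 exactly one off-diagonal entry is $1$, and all other off-diagonal entries are $0$. - $A$ is normal if it is a block diagonal matrix $\begin{pmatrix} M & 0 \\ 0 & D\end{pmatrix}$ with diagonal blocks $M, D$, where $D$ is a diagonal matrix with all diagonal entries nonzero ($D$ may be empty, i.e. of size $0$), and $M$ has the following two properties: (i) all diagonal entries of $M$ are nonzero; (ii) $M$ is of size $r \times r$ with $r \geq 2$ and is fully indecomposable, that is, there is no $s \in \{1,\dots,r-1\}$ such that $M$ has an $s \times (r-s)$ zero submatrix (given by an arbitrary set of $s$ rows and an arbitrary set of $r-s$ columns). - $A$ is desirable if it is tiny or small or special or normal. A desirable $k\times k$-matrix $A$ is row-sum-balanced if any two of its row sums differ by at most $1$, column-sum-balanced if any two of its column sums differ by at most $1$, and balanced if it is both row-sum-balanced and column-sum-balanced. Let $A$ be special and let $i \neq j$ be the unique indices with $A(i,j)=1$. - $A$ is (a)-special if it is row-sum-balanced and the sum of the entries in row $j$ is $\lfloor n/k \rfloor$. - $A$ is (b)-special if it is column-sum-balanced and the sum of the entries in column $i$ is $\lfloor n/k \rfloor$ (equivalently, the transpose of $A$ is (a)-special). - $A$ is (c)-special if $A(i,i)=A(j,j)=\alpha-1$, $A(\ell,\ell) \in \{\alpha,\alpha+1\}$ for all $\ell$ distinct from $i,j$, and $A(\ell,\ell)=\alpha+1$ for at least one $\ell$. - $A$ is very special if it is (a)-, (b)-, or (c)-special. A normal matrix $A$, with diagonal blocks $M,D$ as in the definition of normal, is mininormal if $A$ is balanced, $M=\begin{pmatrix} 1 & 1 \\ 1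 & 1 \end{pmatrix}$, and $2k \leq n < 3k$. *)

theory Defs
  imports
    "HOL-Library.Ramsey"
    "HOL-Library.Disjoint_Sets"
    "Jordan_Normal_Form.Matrix"
begin

type_synonym 'a graph = "'a set \<times> 'a set set"

abbreviation verts :: "'a graph \<Rightarrow> 'a set" where "verts \<equiv> fst"
abbreviation edges :: "'a graph \<Rightarrow> 'a set set" where "edges \<equiv> snd"

definition simple_graph :: "'a graph \<Rightarrow> bool" where
  "simple_graph G \<longleftrightarrow> finite (verts G) \<and> edges G \<subseteq> nsets (verts G) 2"

definition graph_iso :: "'a graph \<Rightarrow> 'b graph \<Rightarrow> bool" where
  "graph_iso G H \<longleftrightarrow> (\<exists>f. bij_betw f (verts G) (verts H) \<and>
     (\<forall>u\<in>verts G. \<forall>v\<in>verts G. {u, v} \<in> edges G \<longleftrightarrow> {f u, f v} \<in> edges H))"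

definition anticlique :: "'a graph \<Rightarrow> 'a set \<Rightarrow> bool" where
  "anticlique G C \<longleftrightarrow> C \<subseteq> verts G \<and> indep C (edges G)"

definition coloring :: "nat \<Rightarrow> 'a graph \<Rightarrow> 'a set set \<Rightarrow> bool" where
  "coloring k G P \<longleftrightarrow> partition_on (verts G) P \<and> card P \<le> k \<and> (\<forall>C\<in>P. anticlique G C)"

definition ambiguously_colorable :: "nat \<Rightarrow> 'a graph \<Rightarrow> bool" where
  "ambiguously_colorable k G \<longleftrightarrow> (\<exists>P Q. coloring k G P \<and> coloring k G Q \<and> P \<noteq> Q)"

definition contains_complete :: "nat \<Rightarrow> 'a graph \<Rightarrow> bool" where
  "contains_complete m G \<longleftrightarrow> (\<exists>K \<subseteq> verts G. card K = m \<and> clique K (edges G))"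

text \<open>
  Both maxima below range over graphs with vertices in \<^typ>\<open>nat\<close>, which represent all finite
  graphs up to isomorphism. The second argument of \<open>ex_complete\<close> is the order of the
  forbidden complete graph.
\<close>

definition ex_complete :: "nat \<Rightarrow> nat \<Rightarrow> nat" where
  "ex_complete n m = Max {card (edges G) | G :: nat graph.
     simple_graph G \<and> card (verts G) = n \<and> \<not> contains_complete m G}"

definition max_edges_ambiguous :: "nat \<Rightarrow> nat \<Rightarrow> nat" where
  "max_edges_ambiguous n k = Max {card (edges G) | G :: nat graph.
     simple_graph G \<and> card (verts G) = n \<and> ambiguously_colorable k G}"

text \<open>
  Rows, columns and the copies of a vertex are counted from 0. The number of vertices of
  \<open>matrix_graph A\<close> is \<^term>\<open>sum_mat A\<close>.
\<close>

definition matrix_graph :: "nat mat \<Rightarrow> (nat \<times> nat \<times> nat) graph" where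
  "matrix_graph A =
     (let V = {(i, j, t). i < dim_row A \<and> j < dim_col A \<and> t < A $$ (i, j)}
      in (V, {{(i, j, t), (i', j', t')} | i j t i' j' t'.
               (i, j, t) \<in> V \<and> (i', j', t') \<in> V \<and> i \<noteq> i' \<and> j \<noteq> j'}))"

definition tiny :: "nat mat \<Rightarrow> bool" where
  "tiny A \<longleftrightarrow> diagonal_mat A \<and>
     card {i. i < dim_row A \<and> A $$ (i, i) = 2} = 1 \<and>
     (\<forall>i < dim_row A. A $$ (i, i) \<noteq> 2 \<longrightarrow> A $$ (i, i) \<le> 1) \<and>
     card {i. i < dim_row A \<and> A $$ (i, i) = 0} \<ge> 2"

definition small :: "nat mat \<Rightarrow> bool" where
  "small A \<longleftrightarrow> diagonal_mat A \<and>
     (\<exists>i < dim_row A. A $$ (i, i) = 2) \<and>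
     (\<forall>i < dim_row A. A $$ (i, i) \<le> 2) \<and>
     card {i. i < dim_row A \<and> A $$ (i, i) = 0} = 1"

text \<open>Here \<open>(i, j)\<close> is the position of the off-diagonal entry 1.\<close>

definition special_at :: "nat mat \<Rightarrow> nat \<Rightarrow> nat \<Rightarrow> bool" where
  "special_at A i j \<longleftrightarrow>
     (\<forall>l < dim_row A. A $$ (l, l) \<noteq> 0) \<and>
     i < dim_row A \<and> j < dim_col A \<and> i \<noteq> j \<and> A $$ (i, j) = 1 \<and>
     (\<forall>a < dim_row A. \<forall>b < dim_col A. a \<noteq> b \<and> (a, b) \<noteq> (i, j) \<longrightarrow> A $$ (a, b) = 0)"

definition special :: "nat mat \<Rightarrow> bool" where
  "special A \<longleftrightarrow> (\<exists>i j. special_at A i j)"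

definition fully_indecomposable :: "nat mat \<Rightarrow> bool" where
  "fully_indecomposable M \<longleftrightarrow>
     (let r = dim_row M in
      \<not> (\<exists>s \<in> {1..r - 1}. \<exists>I \<subseteq> {..<r}. \<exists>J \<subseteq> {..<r}. card I = s \<and> card J = r - s \<and>
            (\<forall>i\<in>I. \<forall>j\<in>J. M $$ (i, j) = 0)))"

definition normal_blocks :: "nat mat \<Rightarrow> nat mat \<Rightarrow> nat mat \<Rightarrow> bool" where
  "normal_blocks A M D \<longleftrightarrow>
     (\<exists>r d. r \<ge> 2 \<and> M \<in> carrier_mat r r \<and> D \<in> carrier_mat d d \<and>
        A = four_block_mat M (0\<^sub>m r d) (0\<^sub>m d r) D \<and>
        (\<forall>i < r. M $$ (i, i) \<noteq> 0) \<and> fully_indecomposable M \<and>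
        diagonal_mat D \<and> (\<forall>i < d. D $$ (i, i) \<noteq> 0))"

definition normal :: "nat mat \<Rightarrow> bool" where
  "normal A \<longleftrightarrow> (\<exists>M D. normal_blocks A M D)"

definition desirable :: "nat mat \<Rightarrow> bool" where
  "desirable A \<longleftrightarrow> tiny A \<or> small A \<or> special A \<or> normal A"

definition row_sum :: "nat mat \<Rightarrow> nat \<Rightarrow> nat" where
  "row_sum A i = (\<Sum>j < dim_col A. A $$ (i, j))"

definition col_sum :: "nat mat \<Rightarrow> nat \<Rightarrow> nat" where
  "col_sum A j = (\<Sum>i < dim_row A. A $$ (i, j))"

definition row_sum_balanced :: "nat mat \<Rightarrow> bool" where
  "row_sum_balanced A \<longleftrightarrow>
     (\<forall>i < dim_row A. \<forall>i' < dim_row A. row_sum A i \<le> row_sum A i' + 1)"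

definition col_sum_balanced :: "nat mat \<Rightarrow> bool" where
  "col_sum_balanced A \<longleftrightarrow>
     (\<forall>j < dim_col A. \<forall>j' < dim_col A. col_sum A j \<le> col_sum A j' + 1)"

definition balanced :: "nat mat \<Rightarrow> bool" where
  "balanced A \<longleftrightarrow> row_sum_balanced A \<and> col_sum_balanced A"

definition a_special :: "nat mat \<Rightarrow> bool" where
  "a_special A \<longleftrightarrow> (\<exists>i j. special_at A i j \<and>
     row_sum_balanced A \<and> row_sum A j = sum_mat A div dim_row A)"

definition b_special :: "nat mat \<Rightarrow> bool" where
  "b_special A \<longleftrightarrow> (\<exists>i j. special_at A i j \<and>
     col_sum_balanced A \<and> col_sum A i = sum_mat A div dim_row A)"

text \<open>
  The condition that an entry equals \<open>\<alpha> - 1\<close> is stated without truncated subtraction.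
\<close>

definition c_special :: "nat mat \<Rightarrow> bool" where
  "c_special A \<longleftrightarrow>
     (let k = dim_row A; \<alpha> = sum_mat A div k in
      \<exists>i j. special_at A i j \<and>
        A $$ (i, i) + 1 = \<alpha> \<and> A $$ (j, j) + 1 = \<alpha> \<and>
        (\<forall>l < k. l \<noteq> i \<and> l \<noteq> j \<longrightarrow> A $$ (l, l) \<in> {\<alpha>, \<alpha> + 1}) \<and>
        (\<exists>l < k. A $$ (l, l) = \<alpha> + 1))"

definition very_special :: "nat mat \<Rightarrow> bool" where
  "very_special A \<longleftrightarrow> a_special A \<or> b_special A \<or> c_special A"

definition mininormal :: "nat mat \<Rightarrow> bool" where
  "mininormal A \<longleftrightarrow>
     (\<exists>M D. normal_blocks A M D \<and> balanced A \<and> M = mat 2 2 (\<lambda>_. 1) \<and>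
        2 * dim_row A \<le> sum_mat A \<and> sum_mat A < 3 * dim_row A)"

end

theory Submission
  imports Defs "HOL-Combinatorics.Transposition"
begin

text \<open>
  With \<open>m = n div k\<close>, a sum of squares of \<open>k\<close> numbers of total \<open>n\<close> exceeds its minimum by
  \<open>\<Sum> x (x - 1)\<close>, where \<open>x\<close> runs over the deviations from \<open>m\<close>. This measures the edges lost by an
  unbalanced coloring; edges are counted through the ordered nonadjacent pairs, the diagonal included.

  Let \<open>G\<close> be ambiguously \<open>k\<close>-colorable with \<open>n \<ge> k\<close>. If \<open>G\<close> has no clique of order \<open>k\<close>, Turan's theorem
  for \<open>k - 1\<close> classes gives the bound, and equality forces \<open>m = 1\<close> and a complement that is a matching.
  Otherwise a clique of order \<open>k\<close> provides common representatives of the classes of two colorings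
  \<open>p\<close> and \<open>q\<close>. Each vertex \<open>u\<close> with \<open>p u \<noteq> q u\<close> loses its edges to the vertices whose two colors both
  equal \<open>q u\<close>. If \<open>w\<close> is one such vertex, these losses add up to at least the size \<open>R\<close> of the class
  \<open>q w\<close> of \<open>p\<close>. With \<open>y = R - m\<close>, twice the loss plus the deviation term of this class is
  \<open>2 m + y (y + 1) \<ge> 2 m\<close>. In the case of equality at most two vertices have different colors; the
  entries of the resulting matrix are then pinned down by the vanishing of the deviation terms.
\<close>

section \<open>Nonadjacent pairs and Turan's theorem\<close>

text \<open>With the diagonal included, a complete multipartite graph has as many such pairs as the
  sum of the squares of its class sizes.\<close>

definition nonadj :: "'a graph \<Rightarrow> ('a \<times> 'a) set" where
  "nonadj G = {(u, v). u \<in> verts G \<and> v \<in> verts G \<and> {u, v} \<notin> edges G}"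

lemma finite_nonadj: "finite (verts G) \<Longrightarrow> finite (nonadj G)"
  by (rule finite_subset[of _ "verts G \<times> verts G"]) (auto simp: nonadj_def)

lemma simple_graph_finite_edges: "simple_graph G \<Longrightarrow> finite (edges G)"
  by (metis simple_graph_def finite_imp_finite_nsets finite_subset)

lemma simple_graph_no_loop: "simple_graph G \<Longrightarrow> {v} \<notin> edges G"
  by (auto simp: simple_graph_def nsets_def)

text \<open>All ordered pairs of vertices split into the nonadjacent ones and the two orientations
  of each edge, so maximizing edges means minimizing \<open>nonadj\<close>.\<close>

lemma card_nonadj:
  assumes "simple_graph G"
  shows "card (nonadj G) + 2 * card (edges G) = card (verts G) ^ 2"
proof -
  let ?V = "verts G" and ?E = "edges G"
  let ?B = "\<Union>e\<in>?E. {(u, v). {u, v} = e}"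
  have fV: "finite ?V" and E: "?E \<subseteq> nsets ?V 2"
    using assms by (auto simp: simple_graph_def)
  have fE: "finite ?E"
    using assms by (rule simple_graph_finite_edges)
  have two: "finite {(u, v). {u, v} = e} \<and> card {(u, v). {u, v} = e} = 2" if e: "e \<in> ?E" for e
  proof -
    obtain a b where "e = {a, b}" "a \<noteq> b"
      using e E by (auto simp: nsets_def card_2_iff subset_iff)
    then have "{(u, v). {u, v} = e} = {(a, b), (b, a)}"
      by (auto simp: doubleton_eq_iff)
    then show ?thesis
      using \<open>a \<noteq> b\<close> by simp
  qed
  have "card ?B = (\<Sum>e\<in>?E. card {(u, v). {u, v} = e})"
    using fE two by (intro card_UN_disjoint) auto
  also have "\<dots> = 2 * card ?E"
    using two by simp
  finally have B: "card ?B = 2 * card ?E" .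
  have "?V \<times> ?V = nonadj G \<union> ?B"
    using E by (fastforce simp: nonadj_def nsets_def)
  moreover have "nonadj G \<inter> ?B = {}"
    by (auto simp: nonadj_def)
  moreover have "finite ?B"
    using fE two by auto
  ultimately have "card (?V \<times> ?V) = card (nonadj G) + card ?B"
    using finite_nonadj[OF fV] by (simp add: card_Un_disjoint)
  then show ?thesis
    by (simp add: B power2_eq_square card_cartesian_product)
qed

section \<open>Sums of squares with given total\<close>

text \<open>For positive \<open>k\<close>, the sum of squares of a balanced partition:
  \<open>n mod k\<close> parts of size \<open>n div k + 1\<close>, the others of size
  \<open>n div k\<close>.\<close>

definition min_sq :: "nat \<Rightarrow> nat \<Rightarrow> int" where
  "min_sq n k = int k * int (n div k) ^ 2 + (2 * int (n div k) + 1) * int (n mod k)"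

text \<open>The excess of x^2 over (2m + 1) x - m (m + 1), the line through the squares at m and m +
  1.\<close>

definition gap :: "nat \<Rightarrow> nat \<Rightarrow> int" where
  "gap m x = (int x - int m) * (int x - int m - 1)"

lemma mult_pred_nonneg: "(x :: int) * (x - 1) \<ge> 0"
  by (cases "x \<le> 0") (auto simp: zero_le_mult_iff)

lemma gap_nonneg: "gap m x \<ge> 0"
  unfolding gap_def by (rule mult_pred_nonneg)

lemma gap_eq_0_iff: "gap m x = 0 \<longleftrightarrow> x = m \<or> x = m + 1"
  by (auto simp: gap_def)

text \<open>Once the gaps are split off, each square becomes a linear function of
  \<open>a i\<close>, and its sum depends only on \<open>n\<close> and \<open>k\<close>.\<close>

lemma sum_squares_eq:
  assumes "card I = k" and "sum a I = n"
  shows "(\<Sum>i\<in>I. int (a i) ^ 2) = min_sq n k + (\<Sum>i\<in>I. gap (n div k) (a i))"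
proof -
  let ?m = "int (n div k)" and ?r = "int (n mod k)"
  have n: "(\<Sum>i\<in>I. int (a i)) = int k * ?m + ?r"
    by (simp flip: assms(2) of_nat_sum of_nat_mult of_nat_add)
  have "(\<Sum>i\<in>I. int (a i) ^ 2)
      = (\<Sum>i\<in>I. gap (n div k) (a i) + (2 * ?m + 1) * int (a i) - ?m * (?m + 1))"
    by (intro sum.cong) (auto simp: gap_def algebra_simps power2_eq_square)
  also have "\<dots> = (\<Sum>i\<in>I. gap (n div k) (a i)) + (2 * ?m + 1) * (int k * ?m + ?r) - int k * (?m * (?m + 1))"
    unfolding n[symmetric] by (simp add: sum.distrib sum_subtractf sum_distrib_left assms(1))
  finally show ?thesis
    by (simp add: min_sq_def algebra_simps power2_eq_square)
qed

lemma sum_squares_ge: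
  assumes "card I = k" and "sum a I = n"
  shows "(\<Sum>i\<in>I. int (a i) ^ 2) \<ge> min_sq n k"
  unfolding sum_squares_eq[OF assms] by (simp add: sum_nonneg gap_nonneg)

section \<open>Turan's theorem\<close>

text \<open>Class sizes rather than a numerical bound are produced, so that \<open>no_clique\<close>
  can append an empty class. The induction is on the order of the forbidden clique and, inside it,
  on the number of vertices: removing a largest clique lowers every class size by one.\<close>

lemma turan_class_sizes:
  fixes G :: "'a graph"
  assumes "simple_graph G" and "\<not> contains_complete (Suc k) G"
  shows "\<exists>a. (\<Sum>i<k. a i) = card (verts G) \<and> (\<Sum>i<k. (a i)\<^sup>2) \<le> card (nonadj G)"
  using assms
proof (induction k arbitrary: G)
  case 0
  have "verts G = {}"
  proof (rule ccontr)
    assume "verts G \<noteq> {}"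
    then obtain v where "v \<in> verts G" by auto
    then have "contains_complete (Suc 0) G"
      unfolding contains_complete_def by (intro exI[of _ "{v}"]) (simp add: clique_def)
    with 0 show False by simp
  qed
  then show ?case by simp
next
  case (Suc k)
  \<comment> \<open>The inner induction, at fixed \<open>k\<close>, needs this hypothesis for graphs
    without a clique of order \<open>Suc k\<close>.\<close>
  note outer = Suc.IH
  from Suc.prems show ?case
  proof (induction "card (verts G)" arbitrary: G rule: less_induct)
    case less
    have fV: "finite (verts G)"
      using less.prems by (simp add: simple_graph_def)
    show ?case
    proof (cases "contains_complete (Suc k) G")
      case False
      then obtain a where a: "(\<Sum>i<k. a i) = card (verts G)" "(\<Sum>i<k. (a i)\<^sup>2) \<le> card (nonadj G)"
        using outer less.prems by blast
      \<comment> \<open>The additional class stays empty.\<close>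
      have "(\<Sum>i<Suc k. (a(k := 0)) i) = (\<Sum>i<k. a i)"
        "(\<Sum>i<Suc k. ((a(k := 0)) i)\<^sup>2) = (\<Sum>i<k. (a i)\<^sup>2)"
        by (auto intro!: sum.cong)
      with a show ?thesis by metis
    next
      case True
      then obtain K where K: "K \<subseteq> verts G" "card K = Suc k" "clique K (edges G)"
        by (auto simp: contains_complete_def)
      have fK: "finite K" using K(1) fV by (rule finite_subset)
      define H where "H = (verts G - K, edges G \<inter> Pow (verts G - K))"
      have H: "simple_graph H"
        using less.prems(1) by (auto simp: simple_graph_def H_def nsets_def)
      have "clique L (edges G)" if "clique L (edges H)" for L
        using that by (auto simp: clique_def H_def)
      then have "\<not> contains_complete (Suc (Suc k)) H"
        using less.prems(2) by (fastforce simp: contains_complete_def H_def)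
      moreover have cH: "card (verts H) = card (verts G) - Suc k"
        using K fK by (simp add: H_def card_Diff_subset)
      moreover have cK: "Suc k \<le> card (verts G)"
        using card_mono[OF fV K(1)] K(2) by simp
      ultimately obtain a where a: "(\<Sum>i<Suc k. a i) = card (verts H)"
        "(\<Sum>i<Suc k. (a i)\<^sup>2) \<le> card (nonadj H)"
        using less.hyps[of H] H by auto
      \<comment> \<open>Otherwise \<open>v\<close> would extend \<open>K\<close> to a forbidden
        clique.\<close>
      have "\<exists>w\<in>K. {w, v} \<notin> edges G" if v: "v \<in> verts G - K" for v
      proof (rule ccontr)
        assume "\<not> ?thesis"
        then have "clique (insert v K) (edges G)"
          using K(3) by (auto simp: clique_def insert_commute)
        moreover have "card (insert v K) = Suc (Suc k)"
          using v fK K(2) by simp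
        ultimately have "contains_complete (Suc (Suc k)) G"
          using v K(1) unfolding contains_complete_def by (intro exI[of _ "insert v K"]) auto
        with less.prems(2) show False by simp
      qed
      then obtain h where h: "h v \<in> K" "{h v, v} \<notin> edges G" if "v \<in> verts G - K" for v
        by metis
      let ?W = "verts G - K"
      let ?A = "(\<lambda>v. (v, v)) ` K" and ?B = "(\<lambda>v. (v, h v)) ` ?W" and ?C = "(\<lambda>v. (h v, v)) ` ?W"
      \<comment> \<open>Four disjoint kinds of pairs: those inside \<open>H\<close>, the diagonal of
        \<open>K\<close>, and for each outer \<open>v\<close> the two orders of \<open>v\<close> and
        its non-neighbour \<open>h v\<close>.\<close>
      have "nonadj H \<union> ?A \<union> ?B \<union> ?C \<subseteq> nonadj G"
        using K(1) h simple_graph_no_loop[OF less.prems(1)]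
        by (auto simp: nonadj_def H_def insert_commute)
      then have "card (nonadj H \<union> ?A \<union> ?B \<union> ?C) \<le> card (nonadj G)"
        by (intro card_mono finite_nonadj fV)
      moreover have "card (nonadj H \<union> ?A \<union> ?B \<union> ?C) = card (nonadj H) + card ?A + card ?B + card ?C"
      proof -
        have "finite (nonadj H)" "finite ?A" "finite ?B" "finite ?C"
          using fV fK by (auto simp: H_def intro!: finite_nonadj)
        moreover have "(nonadj H \<union> ?A \<union> ?B) \<inter> ?C = {}" "(nonadj H \<union> ?A) \<inter> ?B = {}" "nonadj H \<inter> ?A = {}"
          using h by (auto simp: nonadj_def H_def)
        ultimately show ?thesis by (simp add: card_Un_disjoint)
      qed
      moreover have "card ?A = Suc k" "card ?B = card (verts H)" "card ?C = card (verts H)"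
        using K(2) by (auto simp: card_image inj_on_def H_def)
      \<comment> \<open>Raising every size by one costs exactly the pairs in \<open>?A\<close>,
        \<open>?B\<close> and \<open>?C\<close>.\<close>
      moreover have "(\<Sum>i<Suc k. (a i + 1)\<^sup>2) = (\<Sum>i<Suc k. (a i)\<^sup>2) + 2 * (\<Sum>i<Suc k. a i) + Suc k"
      proof -
        have "(a i + 1)\<^sup>2 = (a i)\<^sup>2 + 2 * a i + 1" for i
          by (simp add: power2_eq_square)
        then show ?thesis
          by (simp only: sum.distrib sum_distrib_left) simp
      qed
      ultimately have "(\<Sum>i<Suc k. (a i + 1)\<^sup>2) \<le> card (nonadj G)"
        using a by linarith
      moreover have "(\<Sum>i<Suc k. a i + 1) = card (verts G)"
        using a(1) cH cK by (simp add: sum.distrib sum_Suc del: sum.lessThan_Suc)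
      ultimately show ?thesis by blast
    qed
  qed
qed

section \<open>Graphs determined by two colorings\<close>

text \<open>The graph on \<open>V\<close> with the most edges for which both \<open>p\<close> and
  \<open>q\<close> are proper. Equal colorings give complete multipartite graphs; row and column
  index give \<open>matrix_graph\<close>.\<close>

definition bicolored_graph :: "'a set \<Rightarrow> ('a \<Rightarrow> 'b) \<Rightarrow> ('a \<Rightarrow> 'c) \<Rightarrow> 'a graph" where
  "bicolored_graph V p q = (V, {{u, v} | u v. u \<in> V \<and> v \<in> V \<and> p u \<noteq> p v \<and> q u \<noteq> q v})"

lemma verts_bicolored_graph [simp]: "verts (bicolored_graph V p q) = V"
  by (simp add: bicolored_graph_def)

lemma edge_bicolored_graph:
  "{u, v} \<in> edges (bicolored_graph V p q) \<longleftrightarrow> u \<in> V \<and> v \<in> V \<and> p u \<noteq> p v \<and> q u \<noteq> q v"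
proof
  assume "{u, v} \<in> edges (bicolored_graph V p q)"
  then obtain u' v' where "{u, v} = {u', v'}" "u' \<in> V" "v' \<in> V" "p u' \<noteq> p v'" "q u' \<noteq> q v'"
    by (auto simp: bicolored_graph_def)
  then show "u \<in> V \<and> v \<in> V \<and> p u \<noteq> p v \<and> q u \<noteq> q v"
    by (metis doubleton_eq_iff)
qed (auto simp: bicolored_graph_def)

lemma simple_bicolored_graph: "finite V \<Longrightarrow> simple_graph (bicolored_graph V p q)"
  by (auto simp: simple_graph_def bicolored_graph_def nsets_def card_2_iff)

lemma nonadj_bicolored_graph:
  "nonadj (bicolored_graph V p q) = {(u, v). u \<in> V \<and> v \<in> V \<and> (p u = p v \<or> q u = q v)}"
  by (auto simp: nonadj_def edge_bicolored_graph)

lemma card_same_color: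
  assumes "finite V" and "finite I" and "p \<in> V \<rightarrow> I"
  shows "card {(u, v). u \<in> V \<and> v \<in> V \<and> p u = p v} = (\<Sum>i\<in>I. (card {v \<in> V. p v = i})\<^sup>2)"
proof -
  have "{(u, v). u \<in> V \<and> v \<in> V \<and> p u = p v} = (\<Union>i\<in>I. {v \<in> V. p v = i} \<times> {v \<in> V. p v = i})"
    using assms(3) by auto
  also have "card \<dots> = (\<Sum>i\<in>I. card ({v \<in> V. p v = i} \<times> {v \<in> V. p v = i}))"
    using assms by (intro card_UN_disjoint) auto
  finally show ?thesis
    by (simp add: card_cartesian_product power2_eq_square)
qed

lemma sum_card_color:
  assumes "finite V" and "finite I" and "p \<in> V \<rightarrow> I"
  shows "(\<Sum>i\<in>I. card {v \<in> V. p v = i}) = card V"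
proof -
  have "V = (\<Union>i\<in>I. {v \<in> V. p v = i})"
    using assms(3) by auto
  also have "card \<dots> = (\<Sum>i\<in>I. card {v \<in> V. p v = i})"
    using assms by (intro card_UN_disjoint) auto
  finally show ?thesis by simp
qed

text \<open>The class consists of the numbers i + k t below n; comparing t with the quotient decides
  which of them occur. Residues thus form a balanced coloring.\<close>

lemma card_residue_class:
  assumes "i < k"
  shows "card {u \<in> {..<n}. u mod k = i} = n div k + (if i < n mod k then 1 else 0)" (is "_ = ?c")
proof -
  have "i + k * t < n \<longleftrightarrow> t < ?c" for t
  proof (cases "t < n div k")
    case True
    then have "k * Suc t \<le> k * (n div k)" by (intro mult_le_mono2) simp
    also have "\<dots> \<le> n" by simp
    finally show ?thesis using True assms by simp
  next
    case False
    show ?thesis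
    proof (cases "t = n div k")
      case True
      then have "i + k * t < n \<longleftrightarrow> i < n mod k"
        by (metis add.commute mult_div_mod_eq nat_add_left_cancel_less)
      then show ?thesis using True by simp
    next
      case f: False
      with False have "k * Suc (n div k) \<le> k * t" by (intro mult_le_mono2) simp
      moreover have "n < k * Suc (n div k)"
        using assms by (metis dividend_less_times_div mult_Suc_right neq0_conv not_less0)
      ultimately show ?thesis using False f by auto
    qed
  qed
  note bound = this
  have "u \<in> {u \<in> {..<n}. u mod k = i} \<longleftrightarrow> u \<in> (\<lambda>t. i + k * t) ` {..<?c}" for u
  proof
    assume "u \<in> {u \<in> {..<n}. u mod k = i}"
    then have u: "u < n" "u = i + k * (u div k)" by auto
    then have "u div k < ?c" using bound[of "u div k"] by simp
    with u(2) show "u \<in> (\<lambda>t. i + k * t) ` {..<?c}" by blast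
  next
    assume "u \<in> (\<lambda>t. i + k * t) ` {..<?c}"
    then obtain t where "t < ?c" "u = i + k * t" by blast
    then show "u \<in> {u \<in> {..<n}. u mod k = i}"
      using bound[of t] assms by simp
  qed
  then have "{u \<in> {..<n}. u mod k = i} = (\<lambda>t. i + k * t) ` {..<?c}"
    by blast
  then show ?thesis
    using assms by (simp add: card_image inj_on_def)
qed

lemma sum_squares_residue_classes:
  assumes "k > 0"
  shows "(\<Sum>i<k. int (card {u \<in> {..<n}. u mod k = i}) ^ 2) = min_sq n k"
proof -
  have "(\<Sum>i<k. card {u \<in> {..<n}. u mod k = i}) = n"
    using assms by (subst sum_card_color) auto
  moreover have "gap (n div k) (card {u \<in> {..<n}. u mod k = i}) = 0" if "i < k" for i
    unfolding card_residue_class[OF that] gap_eq_0_iff by simp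
  ultimately show ?thesis
    using sum_squares_eq[of "{..<k}" k "\<lambda>i. card {u \<in> {..<n}. u mod k = i}" n] by simp
qed

text \<open>A proper coloring is injective on a clique.\<close>

lemma not_contains_complete_bicolored:
  assumes "finite I" and "p \<in> V \<rightarrow> I" and "card I < m"
  shows "\<not> contains_complete m (bicolored_graph V p q)"
proof
  assume "contains_complete m (bicolored_graph V p q)"
  then obtain K where K: "K \<subseteq> V" "card K = m" "clique K (edges (bicolored_graph V p q))"
    by (auto simp: contains_complete_def)
  then have "inj_on p K"
    by (fastforce simp: clique_def edge_bicolored_graph inj_on_def)
  moreover have "p ` K \<subseteq> I" using K(1) assms(2) by auto
  ultimately have "card K \<le> card I" using assms(1) by (metis card_inj_on_le)
  with K(2) assms(3) show False by simp
qed

lemma turan_bound: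
  assumes "simple_graph G" and "\<not> contains_complete (k + 1) G"
  shows "min_sq (card (verts G)) k \<le> int (card (nonadj G))"
proof -
  obtain a where a: "(\<Sum>i<k. a i) = card (verts G)" "(\<Sum>i<k. (a i)\<^sup>2) \<le> card (nonadj G)"
    using turan_class_sizes[of G k] assms by auto
  have "min_sq (card (verts G)) k \<le> (\<Sum>i<k. int (a i) ^ 2)"
    using a(1) by (intro sum_squares_ge) auto
  also have "\<dots> \<le> int (card (nonadj G))"
    using a(2) by (simp flip: of_nat_power of_nat_sum)
  finally show ?thesis .
qed

text \<open>Makes \<open>Max\<close> meaningful; the predicate \<open>P\<close> covers both
  maxima.\<close>

lemma finite_edge_counts:
  "finite {card (edges G) | G. simple_graph G \<and> card (verts G) = n \<and> P G}"
proof (rule finite_subset)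
  show "{card (edges G) | G. simple_graph G \<and> card (verts G) = n \<and> P G} \<subseteq> {..n\<^sup>2}"
    using card_nonadj by fastforce
qed simp

text \<open>The coloring by residues attains the bound of \<open>turan_bound\<close>. The factor 2
  and the integers avoid division and truncated subtraction.\<close>

lemma ex_complete_eq:
  assumes "k > 0"
  shows "2 * int (ex_complete n (k + 1)) = int n ^ 2 - min_sq n k"
proof -
  let ?S = "{card (edges G) | G :: nat graph.
     simple_graph G \<and> card (verts G) = n \<and> \<not> contains_complete (k + 1) G}"
  let ?T = "bicolored_graph {..<n} (\<lambda>u. u mod k) (\<lambda>u. u mod k)"
  have T: "simple_graph ?T" by (simp add: simple_bicolored_graph)
  have "card (nonadj ?T) = (\<Sum>i<k. (card {u \<in> {..<n}. u mod k = i})\<^sup>2)"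
    unfolding nonadj_bicolored_graph using assms
    by (subst card_same_color[symmetric]) (auto intro!: arg_cong[of _ _ card])
  then have N: "int (card (nonadj ?T)) = min_sq n k"
    using sum_squares_residue_classes[OF assms, of n] by simp
  have "card (edges ?T) \<in> ?S"
    using T not_contains_complete_bicolored[of "{..<k}" "\<lambda>u. u mod k" "{..<n}" "k + 1"] assms
    by fastforce
  moreover have "c \<le> card (edges ?T)" if c: "c \<in> ?S" for c
  proof -
    obtain G :: "nat graph" where G: "c = card (edges G)" "simple_graph G" "card (verts G) = n"
      "\<not> contains_complete (k + 1) G"
      using c by auto
    have "int (card (nonadj ?T)) \<le> int (card (nonadj G))"
      using turan_bound[OF G(2,4)] N G(3) by simp
    then show ?thesis
      using card_nonadj[OF G(2)] card_nonadj[OF T] G(1,3) by simp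
  qed
  ultimately have "ex_complete n (k + 1) = card (edges ?T)"
    unfolding ex_complete_def using finite_edge_counts by (intro Max_eqI) auto
  then show ?thesis
    using arg_cong[OF card_nonadj[OF T], of int] N by simp
qed

section \<open>Colorings as maps\<close>

definition proper :: "'a graph \<Rightarrow> ('a \<Rightarrow> 'b) \<Rightarrow> bool" where
  "proper G p \<longleftrightarrow> (\<forall>u\<in>verts G. \<forall>v\<in>verts G. p u = p v \<longrightarrow> {u, v} \<notin> edges G)"

text \<open>Colors number the classes. Recovering \<open>P\<close> from the fibres allows colorings
  to be compared as partitions, and surjectivity records that no color is idle.\<close>

lemma coloring_imp_map:
  assumes "simple_graph G" and "coloring k G P"
  shows "\<exists>p. p ` verts G = {..<card P} \<and> proper G p \<and> P = (\<lambda>u. {v \<in> verts G. p v = p u}) ` verts G"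
proof -
  let ?V = "verts G"
  have part: "partition_on ?V P" and anti: "\<And>C. C \<in> P \<Longrightarrow> anticlique G C"
    using assms(2) by (auto simp: coloring_def)
  have fP: "finite P"
    using assms(1) part finite_elements by (auto simp: simple_graph_def)
  obtain f where "bij_betw f P {0..<card P}"
    using ex_bij_betw_finite_nat[OF fP] by blast
  then have f: "inj_on f P" "f ` P = {..<card P}"
    by (auto simp: bij_betw_def atLeast0LessThan)
  have "\<forall>v\<in>?V. \<exists>C. C \<in> P \<and> v \<in> C"
    using partition_onD1[OF part] by blast
  then obtain cl where cl: "\<And>v. v \<in> ?V \<Longrightarrow> cl v \<in> P \<and> v \<in> cl v"
    by metis
  have uniq: "C = cl v" if "C \<in> P" "v \<in> C" for C v
    using that cl[of v] partition_onD1[OF part] disjointD[OF partition_onD2[OF part], of C "cl v"] by blast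
  have sub: "C \<subseteq> ?V" if "C \<in> P" for C
    using partition_onD1[OF part] that by blast
  have P: "P = cl ` ?V"
  proof (intro equalityI subsetI)
    fix C assume C: "C \<in> P"
    then obtain v where "v \<in> C" using partition_onD3[OF part] by (metis all_not_in_conv)
    then show "C \<in> cl ` ?V" using uniq[OF C] sub[OF C] by blast
  next
    fix C assume "C \<in> cl ` ?V"
    then show "C \<in> P" using cl by blast
  qed
  let ?p = "f \<circ> cl"
  have eq: "?p u = ?p v \<longleftrightarrow> cl u = cl v" if "u \<in> ?V" "v \<in> ?V" for u v
    using inj_onD[OF f(1)] cl that by auto
  have "{v \<in> ?V. ?p v = ?p u} = cl u" if "u \<in> ?V" for u
    using eq[OF _ that] cl that uniq sub by blast
  then have "P = (\<lambda>u. {v \<in> ?V. ?p v = ?p u}) ` ?V"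
    using P by simp
  moreover have "?p ` ?V = {..<card P}"
    using f(2) P by (metis image_comp)
  moreover have "proper G ?p"
    unfolding proper_def
  proof (intro ballI impI)
    fix u v assume uv: "u \<in> ?V" "v \<in> ?V" "?p u = ?p v"
    then have "cl u \<in> P" "u \<in> cl u" "v \<in> cl u" using eq cl by auto
    with anti show "{u, v} \<notin> edges G"
      using simple_graph_no_loop[OF assms(1), of u]
      by (cases "u = v") (auto simp: anticlique_def indep_def)
  qed
  ultimately show ?thesis by blast
qed

lemma map_imp_coloring:
  assumes "p \<in> verts G \<rightarrow> {..<k}" and "proper G p"
  shows "coloring k G ((\<lambda>u. {v \<in> verts G. p v = p u}) ` verts G)"
  unfolding coloring_def
proof (intro conjI)
  let ?V = "verts G"
  let ?P = "(\<lambda>u. {v \<in> ?V. p v = p u}) ` ?V"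
  show "partition_on ?V ?P"
    by (rule partition_onI) (auto simp: disjnt_def)
  have "?P = (\<lambda>c. {v \<in> ?V. p v = c}) ` p ` ?V"
    by auto
  also have "card \<dots> \<le> card (p ` ?V)"
    using assms(1) by (intro card_image_le) (auto intro: finite_subset[of _ "{..<k}"])
  also have "\<dots> \<le> k"
    using card_mono[of "{..<k}" "p ` ?V"] assms(1) by auto
  finally show "card ?P \<le> k" .
  show "\<forall>C\<in>?P. anticlique G C"
    using assms(2) by (auto simp: anticlique_def indep_def proper_def)
qed

text \<open>Renaming colors changes the map but not the partition, so inequality of the maps would
  be too weak. Two partitions differ when some pair of vertices is joined by one and separated by
  the other.\<close>

lemma ambiguously_colorable_iff:
  assumes "simple_graph G"
  shows "ambiguously_colorable k G \<longleftrightarrow>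
    (\<exists>p q. p \<in> verts G \<rightarrow> {..<k} \<and> q \<in> verts G \<rightarrow> {..<k} \<and> proper G p \<and> proper G q \<and>
      (\<exists>u\<in>verts G. \<exists>v\<in>verts G. p u = p v \<and> q u \<noteq> q v))" (is "?L \<longleftrightarrow> (\<exists>p q. ?R p q)")
proof
  let ?V = "verts G"
  assume ?L
  then obtain P Q where PQ: "coloring k G P" "coloring k G Q" "P \<noteq> Q"
    by (auto simp: ambiguously_colorable_def)
  obtain p where p: "p ` ?V = {..<card P}" "proper G p" "P = (\<lambda>u. {v \<in> ?V. p v = p u}) ` ?V"
    using coloring_imp_map[OF assms PQ(1)] by blast
  obtain q where q: "q ` ?V = {..<card Q}" "proper G q" "Q = (\<lambda>u. {v \<in> ?V. q v = q u}) ` ?V"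
    using coloring_imp_map[OF assms PQ(2)] by blast
  have "card P \<le> k" "card Q \<le> k"
    using PQ by (auto simp: coloring_def)
  moreover have "f \<in> ?V \<rightarrow> {..<k}" if "f ` ?V = {..<m}" "m \<le> k" for f :: "'a \<Rightarrow> nat" and m
  proof (rule Pi_I)
    fix x assume "x \<in> ?V"
    then have "f x \<in> f ` ?V" by (rule imageI)
    then show "f x \<in> {..<k}" using that(2) unfolding that(1) by simp
  qed
  ultimately have range: "p \<in> ?V \<rightarrow> {..<k}" "q \<in> ?V \<rightarrow> {..<k}"
    using p(1) q(1) by blast+
  have "\<exists>u\<in>?V. \<exists>v\<in>?V. (p u = p v) \<noteq> (q u = q v)"
  proof (rule ccontr)
    assume "\<not> ?thesis"
    then have "{v \<in> ?V. p v = p u} = {v \<in> ?V. q v = q u}" if "u \<in> ?V" for u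
      using that by blast
    then have "P = Q"
      unfolding p(3) q(3) by (rule image_cong[OF refl])
    with PQ(3) show False by contradiction
  qed
  \<comment> \<open>The maps may have to be exchanged for the first one to be the one that joins the
    pair.\<close>
  then have "?R p q \<or> ?R q p"
    using range p(2) q(2) by blast
  then show "\<exists>p q. ?R p q" by blast
next
  let ?V = "verts G"
  assume "\<exists>p q. ?R p q"
  then obtain p q u v where pq: "p \<in> ?V \<rightarrow> {..<k}" "q \<in> ?V \<rightarrow> {..<k}" "proper G p" "proper G q"
    and uv: "u \<in> ?V" "v \<in> ?V" "p u = p v" "q u \<noteq> q v" by blast
  let ?P = "(\<lambda>u. {v \<in> ?V. p v = p u}) ` ?V" and ?Q = "(\<lambda>u. {v \<in> ?V. q v = q u}) ` ?V"
  have "?P \<noteq> ?Q"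
  proof
    assume "?P = ?Q"
    moreover have "{w \<in> ?V. p w = p u} \<in> ?P" using uv(1) by blast
    ultimately obtain z where "{w \<in> ?V. p w = p u} = {w \<in> ?V. q w = q z}" by auto
    then have "q u = q z" "q v = q z" using uv by auto
    with uv(4) show False by simp
  qed
  then show ?L
    using map_imp_coloring pq unfolding ambiguously_colorable_def by blast
qed

section \<open>Invariance under isomorphism\<close>

lemma graph_iso_card_verts: "graph_iso G H \<Longrightarrow> card (verts G) = card (verts H)"
  by (auto simp: graph_iso_def dest: bij_betw_same_card)

lemma graph_iso_card_nonadj:
  assumes "graph_iso G H"
  shows "card (nonadj G) = card (nonadj H)"
proof -
  obtain f where f: "bij_betw f (verts G) (verts H)"
    "\<And>u v. u \<in> verts G \<Longrightarrow> v \<in> verts G \<Longrightarrow> {u, v} \<in> edges G \<longleftrightarrow> {f u, f v} \<in> edges H"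
    using assms by (auto simp: graph_iso_def)
  have im: "f ` verts G = verts H" and inj: "inj_on f (verts G)"
    using f(1) by (auto simp: bij_betw_def)
  have "nonadj H = map_prod f f ` nonadj G"
  proof (intro subset_antisym subrelI)
    fix x y assume "(x, y) \<in> nonadj H"
    moreover from this obtain u v where "u \<in> verts G" "v \<in> verts G" "x = f u" "y = f v"
      unfolding nonadj_def im[symmetric] by blast
    ultimately show "(x, y) \<in> map_prod f f ` nonadj G"
      using f(2) by (force simp: nonadj_def)
  next
    fix x y assume "(x, y) \<in> map_prod f f ` nonadj G"
    then show "(x, y) \<in> nonadj H"
      using f(2) im by (auto simp: nonadj_def)
  qed
  moreover have "inj_on (map_prod f f) (nonadj G)"
    using inj by (rule inj_on_subset[OF map_prod_inj_on, OF _ inj]) (auto simp: nonadj_def)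
  ultimately show ?thesis by (simp add: card_image)
qed

lemma graph_iso_ambiguously_colorable:
  assumes "graph_iso G H" and "simple_graph G" and "simple_graph H" and "ambiguously_colorable k H"
  shows "ambiguously_colorable k G"
proof -
  obtain f where f: "bij_betw f (verts G) (verts H)"
    "\<And>u v. u \<in> verts G \<Longrightarrow> v \<in> verts G \<Longrightarrow> {u, v} \<in> edges G \<longleftrightarrow> {f u, f v} \<in> edges H"
    using assms(1) by (auto simp: graph_iso_def)
  have im: "f ` verts G = verts H"
    using f(1) by (auto simp: bij_betw_def)
  obtain p q u v where pq: "p \<in> verts H \<rightarrow> {..<k}" "q \<in> verts H \<rightarrow> {..<k}" "proper H p" "proper H q"
    and uv: "u \<in> verts H" "v \<in> verts H" "p u = p v" "q u \<noteq> q v"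
    using assms(4) unfolding ambiguously_colorable_iff[OF assms(3)] by blast
  have fV: "f x \<in> verts H" if "x \<in> verts G" for x
    using im that by blast
  have comp: "p' \<circ> f \<in> verts G \<rightarrow> {..<k}" "proper G (p' \<circ> f)"
    if "p' \<in> verts H \<rightarrow> {..<k}" "proper H p'" for p'
    using that fV f(2) unfolding proper_def by auto
  obtain u' v' where "u' \<in> verts G" "v' \<in> verts G" "u = f u'" "v = f v'"
    using uv im by blast
  then show ?thesis
    unfolding ambiguously_colorable_iff[OF assms(2)] using comp pq uv
    by (intro exI[of _ "p \<circ> f"] exI[of _ "q \<circ> f"]) auto
qed

lemma proper_bicolored_graph:
  "proper (bicolored_graph V p q) p" "proper (bicolored_graph V p q) q"
  by (auto simp: proper_def edge_bicolored_graph)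

lemma nonadj_superset:
  assumes "proper G p" and "proper G q"
  shows "nonadj (bicolored_graph (verts G) p q) \<subseteq> nonadj G"
  using assms unfolding nonadj_bicolored_graph by (auto simp: nonadj_def proper_def)

lemma ambiguous_nonadj:
  assumes "simple_graph G" and "ambiguously_colorable k G"
  shows "\<exists>u v. (u, v) \<in> nonadj G \<and> u \<noteq> v"
  using assms(2) unfolding ambiguously_colorable_iff[OF assms(1)] nonadj_def proper_def by blast

section \<open>The lower bound for colorings with common representatives\<close>

text \<open>The last product is nonnegative, so the gap of a class together with twice its size is
  at least 2 m.\<close>

lemma gap_plus: "gap m x + 2 * int x = 2 * int m + (int x - int m) * (int x - int m + 1)"
  by (simp add: gap_def algebra_simps)

lemma mult_succ_nonneg: "(x :: int) * (x + 1) \<ge> 0"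
  using mult_pred_nonneg[of "x + 1"] by (simp add: mult.commute)

text \<open>
  Both colorings share the representatives in the cells \<open>D i\<close>. A vertex \<open>u\<close> whose two colors
  differ loses its edges to the cell \<open>D (q u)\<close>, on top of the pairs inside the classes of \<open>p\<close>.
\<close>

locale common_representatives =
  fixes G :: "'a graph" and k :: nat and p q :: "'a \<Rightarrow> nat"
  assumes simple: "simple_graph G"
    and p_range: "p \<in> verts G \<rightarrow> {..<k}" and q_range: "q \<in> verts G \<rightarrow> {..<k}"
    and p_proper: "proper G p" and q_proper: "proper G q"
    and representatives: "i < k \<Longrightarrow> \<exists>v\<in>verts G. p v = i \<and> q v = i"
begin

definition D :: "nat \<Rightarrow> 'a set" where
  "D i = {v \<in> verts G. p v = i \<and> q v = i}"

definition U :: "'a set" where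
  "U = {u \<in> verts G. p u \<noteq> q u}"

lemma finite_verts: "finite (verts G)"
  using simple by (simp add: simple_graph_def)

lemma finite_D: "finite (D i)" and finite_U: "finite U"
  using finite_verts by (auto simp: D_def U_def)

lemma card_D_pos: "i < k \<Longrightarrow> card (D i) > 0"
  using representatives[of i] finite_D[of i] by (auto simp: card_gt_0_iff D_def)

lemma U_q_less: "u \<in> U \<Longrightarrow> q u < k"
  using q_range by (auto simp: U_def)

text \<open>Besides the pairs of equal \<open>p\<close>-color, each recolored \<open>u\<close> is
  nonadjacent to the cell \<open>D (q u)\<close>, in both orders. The three sets are disjoint
  because p u \<noteq> q u and because \<open>U\<close> misses all cells.\<close>

lemma card_nonadj_ge:
  "(\<Sum>i<k. (card {v \<in> verts G. p v = i})\<^sup>2) + 2 * (\<Sum>u\<in>U. card (D (q u))) \<le> card (nonadj G)"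
proof -
  let ?S = "{(u, v). u \<in> verts G \<and> v \<in> verts G \<and> p u = p v}"
  let ?W = "Sigma U (\<lambda>u. D (q u))"
  have S: "card ?S = (\<Sum>i<k. (card {v \<in> verts G. p v = i})\<^sup>2)"
    using finite_verts p_range by (intro card_same_color) auto
  have W: "card ?W = (\<Sum>u\<in>U. card (D (q u)))"
    using finite_D finite_U by (simp add: card_SigmaI)
  have "card (?S \<union> ?W \<union> prod.swap ` ?W) = card ?S + card ?W + card (prod.swap ` ?W)"
  proof -
    have "finite ?S"
      by (rule finite_subset[of _ "verts G \<times> verts G"]) (use finite_verts in auto)
    moreover have "finite ?W" using finite_D finite_U by auto
    moreover have "(?S \<union> ?W) \<inter> prod.swap ` ?W = {}" "?S \<inter> ?W = {}"
      by (auto simp: U_def D_def)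
    ultimately show ?thesis by (simp add: card_Un_disjoint)
  qed
  moreover have "card (prod.swap ` ?W) = card ?W"
    by (intro card_image) (auto intro: inj_on_subset[OF inj_swap])
  moreover have "?S \<union> ?W \<union> prod.swap ` ?W \<subseteq> nonadj (bicolored_graph (verts G) p q)"
    unfolding nonadj_bicolored_graph by (auto simp: U_def D_def)
  then have "card (?S \<union> ?W \<union> prod.swap ` ?W) \<le> card (nonadj G)"
    using nonadj_superset[OF p_proper q_proper] finite_nonadj[OF finite_verts] by (intro card_mono) auto
  ultimately show ?thesis using S W by simp
qed

text \<open>The class \<open>q w\<close> of \<open>p\<close> consists of \<open>D (q w)\<close> and
  of recolored vertices other than \<open>w\<close>. The loss of \<open>w\<close> covers the cell,
  and each other recolored vertex loses at least one because its target cell is nonempty. Equality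
  forces all the others into this class, each with loss one.\<close>

lemma row_le_loss:
  assumes "w \<in> U"
  defines "R \<equiv> card {v \<in> verts G. p v = q w}" and "loss \<equiv> \<Sum>u\<in>U. card (D (q u))"
  shows "R \<le> loss"
    and "loss = R \<Longrightarrow> u \<in> U \<Longrightarrow> u \<noteq> w \<Longrightarrow> p u = q w \<and> card (D (q u)) = 1"
proof -
  let ?out = "{u \<in> U. p u = q w}"
  have R: "R = card (D (q w)) + card ?out"
  proof -
    have "{v \<in> verts G. p v = q w} = D (q w) \<union> ?out" "D (q w) \<inter> ?out = {}"
      by (auto simp: D_def U_def)
    then show ?thesis using finite_D finite_U by (simp add: R_def card_Un_disjoint)
  qed
  have sub: "?out \<subseteq> U - {w}"
    by (auto simp: U_def)
  have le: "card ?out \<le> card (U - {w})"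
    using finite_U sub by (intro card_mono) auto
  have one: "1 \<le> card (D (q u))" if "u \<in> U" for u
    using card_D_pos[OF U_q_less[OF that]] by simp
  have sum_le: "(\<Sum>u\<in>U - {w}. 1) \<le> (\<Sum>u\<in>U - {w}. card (D (q u)))"
    using one by (intro sum_mono) auto
  have loss: "loss = card (D (q w)) + (\<Sum>u\<in>U - {w}. card (D (q u)))"
    unfolding loss_def using finite_U assms(1) by (rule sum.remove)
  show "R \<le> loss"
    using R le sum_le loss by simp
  assume eq: "loss = R" and u: "u \<in> U" "u \<noteq> w"
  have "card ?out = card (U - {w})"
    using R le sum_le loss eq by simp
  then have "?out = U - {w}"
    using card_subset_eq[OF _ sub] finite_U by simp
  moreover have "card (D (q u)) = 1"
  proof (rule ccontr)
    assume "card (D (q u)) \<noteq> 1"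
    then have "(\<Sum>u\<in>U - {w}. 1) < (\<Sum>u\<in>U - {w}. card (D (q u)))"
      using one u finite_U by (intro sum_strict_mono_ex1) (auto intro!: bexI[of _ u] le_neq_implies_less)
    then show False using R le loss eq by simp
  qed
  ultimately show "p u = q w \<and> card (D (q u)) = 1"
    using u by auto
qed

text \<open>Of all gaps only that of the class \<open>q w\<close> is kept; \<open>gap_plus\<close>
  bounds it together with twice the class size. The equality statement holds for every
  \<open>w\<close> in \<open>U\<close>, which \<open>few_recolored\<close> exploits.\<close>

lemma nonadj_lower_bound:
  assumes "w \<in> U"
  defines "n \<equiv> card (verts G)"
  shows "min_sq n k + 2 * int (n div k) \<le> int (card (nonadj G))"
    and "int (card (nonadj G)) = min_sq n k + 2 * int (n div k) \<Longrightarrow> u \<in> U \<Longrightarrow> u \<noteq> w \<Longrightarrow>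
      p u = q w \<and> card (D (q u)) = 1"
proof -
  let ?c = "\<lambda>i. card {v \<in> verts G. p v = i}"
  let ?j = "q w"
  define m where "m = n div k"
  define loss where "loss = (\<Sum>u\<in>U. card (D (q u)))"
  have j: "?j < k" using assms(1) by (rule U_q_less)
  have "(\<Sum>i<k. ?c i) = n"
    unfolding n_def using finite_verts p_range by (intro sum_card_color) auto
  then have sq: "(\<Sum>i<k. int (?c i) ^ 2) = min_sq n k + (\<Sum>i<k. gap m (?c i))"
    unfolding m_def by (intro sum_squares_eq) auto
  have "gap m (?c ?j) \<le> (\<Sum>i<k. gap m (?c i))"
    using j gap_nonneg by (intro member_le_sum) auto
  then have "2 * int m \<le> (\<Sum>i<k. gap m (?c i)) + 2 * int (?c ?j)"
    using gap_plus[of m "?c ?j"] mult_succ_nonneg[of "int (?c ?j) - int m"] by linarith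
  moreover have "(\<Sum>i<k. int (?c i) ^ 2) + 2 * int loss \<le> int (card (nonadj G))"
    using card_nonadj_ge unfolding loss_def[symmetric] by (simp flip: of_nat_power of_nat_sum of_nat_mult of_nat_add)
  ultimately have le: "min_sq n k + 2 * int m + 2 * (int loss - int (?c ?j)) \<le> int (card (nonadj G))"
    using sq by arith
  then show "min_sq n k + 2 * int (n div k) \<le> int (card (nonadj G))"
    unfolding m_def[symmetric] using row_le_loss(1)[OF assms(1), folded loss_def] by arith
  assume "int (card (nonadj G)) = min_sq n k + 2 * int (n div k)" and u: "u \<in> U" "u \<noteq> w"
  then have "loss = ?c ?j"
    unfolding m_def[symmetric] using le row_le_loss(1)[OF assms(1), folded loss_def] by arith
  then show "p u = q w \<and> card (D (q u)) = 1"
    using row_le_loss(2)[OF assms(1) _ u, folded loss_def] by blast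
qed

lemma bicolored: "common_representatives (bicolored_graph (verts G) p q) k p q"
  using finite_verts p_range q_range representatives proper_bicolored_graph
  by unfold_locales (auto simp: simple_bicolored_graph)

text \<open>The bicolored graph has no more nonadjacent pairs than \<open>G\<close> and obeys the
  same lower bound, so equality for \<open>G\<close> leaves no room for further missing
  edges.\<close>

lemma nonadj_eq:
  assumes "w \<in> U"
  defines "n \<equiv> card (verts G)"
  assumes "int (card (nonadj G)) = min_sq n k + 2 * int (n div k)"
  shows "nonadj G = nonadj (bicolored_graph (verts G) p q)"
proof -
  interpret B: common_representatives "bicolored_graph (verts G) p q" k p q
    by (rule bicolored)
  have "w \<in> B.U" using assms(1) by (simp add: U_def B.U_def)
  then have "card (nonadj G) \<le> card (nonadj (bicolored_graph (verts G) p q))"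
    using B.nonadj_lower_bound(1)[of w] assms(3) unfolding n_def by simp
  then show ?thesis
    using card_seteq[OF finite_nonadj[OF finite_verts] nonadj_superset[OF p_proper q_proper]] by simp
qed

text \<open>Equality is evaluated at \<open>w\<close> and at a second vertex \<open>u\<close>, which
  makes the two exchange colors. A third vertex \<open>x\<close> would give q w = p x = q u, hence p
  u = q u.\<close>

lemma few_recolored:
  assumes "w \<in> U"
  defines "n \<equiv> card (verts G)"
  assumes eq: "int (card (nonadj G)) = min_sq n k + 2 * int (n div k)"
  shows "U = {w} \<or> (\<exists>u. u \<noteq> w \<and> U = {u, w} \<and> p u = q w \<and> p w = q u \<and>
    card (D (q u)) = 1 \<and> card (D (q w)) = 1)"
proof (cases "U = {w}")
  case False
  note * = nonadj_lower_bound(2)[folded n_def, OF _ eq]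
  from False obtain u where u: "u \<in> U" "u \<noteq> w" using assms(1) by auto
  have uw: "p u = q w" "p w = q u" "card (D (q u)) = 1" "card (D (q w)) = 1"
    using *[OF assms(1) u] *[OF u(1) assms(1)] u(2) by auto
  moreover have "x = u \<or> x = w" if x: "x \<in> U" for x
  proof (rule ccontr)
    assume "\<not> ?thesis"
    then have "p x = q w" "p x = q u"
      using *[OF assms(1) x] *[OF u(1) x] by auto
    then show False using uw u(1) by (simp add: U_def)
  qed
  ultimately show ?thesis using assms(1) u by blast
qed simp

end

section \<open>Matrix graphs\<close>

text \<open>Inclusion-exclusion for the pairs of equal \<open>p\<close>-color and those of equal
  \<open>q\<close>-color; their intersection consists of the pairs within one cell. The additive
  form avoids truncated subtraction.\<close>

lemma card_nonadj_bicolored_graph: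
  assumes "finite V" and "finite I" and "finite J" and "p \<in> V \<rightarrow> I" and "q \<in> V \<rightarrow> J"
  shows "card (nonadj (bicolored_graph V p q)) + (\<Sum>i\<in>I. \<Sum>j\<in>J. (card {v \<in> V. p v = i \<and> q v = j})\<^sup>2)
    = (\<Sum>i\<in>I. (card {v \<in> V. p v = i})\<^sup>2) + (\<Sum>j\<in>J. (card {v \<in> V. q v = j})\<^sup>2)"
proof -
  let ?P = "{(u, v). u \<in> V \<and> v \<in> V \<and> p u = p v}" and ?Q = "{(u, v). u \<in> V \<and> v \<in> V \<and> q u = q v}"
  let ?pq = "\<lambda>v. (p v, q v)"
  have fin: "finite ?P" "finite ?Q"
    by (rule finite_subset[of _ "V \<times> V"], blast, simp add: assms(1))+
  have "card {(u, v). u \<in> V \<and> v \<in> V \<and> ?pq u = ?pq v}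
      = (\<Sum>x\<in>I \<times> J. (card {v \<in> V. ?pq v = x})\<^sup>2)"
    using assms by (intro card_same_color) auto
  moreover have "{(u, v). u \<in> V \<and> v \<in> V \<and> ?pq u = ?pq v} = ?P \<inter> ?Q" by auto
  ultimately have "card (?P \<inter> ?Q) = (\<Sum>i\<in>I. \<Sum>j\<in>J. (card {v \<in> V. p v = i \<and> q v = j})\<^sup>2)"
    by (simp add: sum.cartesian_product case_prod_unfold prod_eq_iff)
  moreover have "nonadj (bicolored_graph V p q) = ?P \<union> ?Q"
    unfolding nonadj_bicolored_graph by auto
  moreover have "card ?P = (\<Sum>i\<in>I. (card {v \<in> V. p v = i})\<^sup>2)"
    "card ?Q = (\<Sum>j\<in>J. (card {v \<in> V. q v = j})\<^sup>2)"
    using assms by (intro card_same_color; simp)+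
  ultimately show ?thesis
    using card_Un_Int[OF fin] by simp
qed

definition cells :: "nat mat \<Rightarrow> (nat \<times> nat \<times> nat) set" where
  "cells A = {(i, j, t). i < dim_row A \<and> j < dim_col A \<and> t < A $$ (i, j)}"

lemma matrix_graph_eq: "matrix_graph A = bicolored_graph (cells A) fst (fst \<circ> snd)"
  unfolding matrix_graph_def bicolored_graph_def cells_def Let_def by (auto; blast)

lemma cells_Sigma:
  "cells A = (SIGMA i:{..<dim_row A}. SIGMA j:{..<dim_col A}. {..<A $$ (i, j)})"
  by (auto simp: cells_def)

lemma finite_cells: "finite (cells A)"
  by (simp add: cells_Sigma)

lemma verts_matrix_graph: "verts (matrix_graph A) = cells A"
  by (simp add: matrix_graph_eq)

lemma simple_matrix_graph: "simple_graph (matrix_graph A)"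
  by (simp add: matrix_graph_eq simple_bicolored_graph finite_cells)

lemma sum_mat_eq: "sum_mat A = (\<Sum>i<dim_row A. row_sum A i)"
  by (simp add: sum_mat_def row_sum_def sum.cartesian_product atLeast0LessThan)

lemma sum_mat_eq_col: "sum_mat A = (\<Sum>j<dim_col A. col_sum A j)"
  unfolding sum_mat_eq row_sum_def col_sum_def by (rule sum.swap)

lemma card_cells: "card (cells A) = sum_mat A"
  by (simp add: cells_Sigma sum_mat_eq row_sum_def)

lemma card_cells_entry:
  assumes "i < dim_row A" and "j < dim_col A"
  shows "card {v \<in> cells A. fst v = i \<and> (fst \<circ> snd) v = j} = A $$ (i, j)"
proof -
  have "{v \<in> cells A. fst v = i \<and> (fst \<circ> snd) v = j} = (\<lambda>t. (i, j, t)) ` {..<A $$ (i, j)}"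
    using assms by (auto simp: cells_def)
  then show ?thesis by (simp add: card_image inj_on_def)
qed

lemma card_cells_row:
  assumes "i < dim_row A"
  shows "card {v \<in> cells A. fst v = i} = row_sum A i"
proof -
  have "{v \<in> cells A. fst v = i} = Pair i ` (SIGMA j:{..<dim_col A}. {..<A $$ (i, j)})"
    using assms by (auto simp: cells_def)
  then show ?thesis by (simp add: card_image inj_on_def row_sum_def)
qed

lemma card_cells_col:
  assumes "j < dim_col A"
  shows "card {v \<in> cells A. (fst \<circ> snd) v = j} = col_sum A j"
proof -
  have "{v \<in> cells A. (fst \<circ> snd) v = j} = (\<lambda>(i, t). (i, j, t)) ` (SIGMA i:{..<dim_row A}. {..<A $$ (i, j)})"
    using assms by (auto simp: cells_def)
  moreover have "inj_on (\<lambda>(i, t). (i, j, t)) X" for X :: "(nat \<times> nat) set"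
    by (auto simp: inj_on_def)
  ultimately show ?thesis by (simp add: card_image col_sum_def)
qed

lemma card_nonadj_matrix_graph:
  "card (nonadj (matrix_graph A)) + (\<Sum>i<dim_row A. \<Sum>j<dim_col A. (A $$ (i, j))\<^sup>2)
    = (\<Sum>i<dim_row A. (row_sum A i)\<^sup>2) + (\<Sum>j<dim_col A. (col_sum A j)\<^sup>2)"
proof -
  have "fst \<in> cells A \<rightarrow> {..<dim_row A}" "fst \<circ> snd \<in> cells A \<rightarrow> {..<dim_col A}"
    by (auto simp: cells_def)
  from card_nonadj_bicolored_graph[OF finite_cells _ _ this] show ?thesis
    unfolding matrix_graph_eq
    by (simp add: card_cells_row card_cells_col card_cells_entry del: comp_apply)
qed

text \<open>Adjacency depends only on the cells of the two vertices, so any numbering of the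
  vertices within each cell yields an isomorphism.\<close>

lemma graph_iso_matrix_graph:
  fixes p q :: "'a \<Rightarrow> nat"
  assumes "finite (verts G)" and "nonadj G = nonadj (bicolored_graph (verts G) p q)"
    and "p \<in> verts G \<rightarrow> {..<k}" and "q \<in> verts G \<rightarrow> {..<k}"
  shows "graph_iso G (matrix_graph (mat k k (\<lambda>(i, j). card {v \<in> verts G. p v = i \<and> q v = j})))"
    (is "graph_iso G (matrix_graph ?A)")
proof -
  let ?V = "verts G"
  let ?cell = "\<lambda>i j. {v \<in> ?V. p v = i \<and> q v = j}"
  have "\<exists>g. bij_betw g (?cell i j) {0..<card (?cell i j)}" for i j
    using assms(1) by (intro ex_bij_betw_finite_nat) simp
  then have "\<exists>g. \<forall>i j. bij_betw (g i j) (?cell i j) {0..<card (?cell i j)}"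
    by (intro choice allI)
  then obtain g where g: "\<And>i j. bij_betw (g i j) (?cell i j) {0..<card (?cell i j)}"
    by blast
  define f where "f v = (p v, q v, g (p v) (q v) v)" for v
  have range: "p v < k" "q v < k" if "v \<in> ?V" for v
    using assms(3,4) that by auto
  have "inj_on f ?V"
  proof (rule inj_onI)
    fix u v assume uv: "u \<in> ?V" "v \<in> ?V" "f u = f v"
    then have eq: "p u = p v" "q u = q v" "g (p u) (q u) u = g (p u) (q u) v"
      by (auto simp: f_def)
    show "u = v"
      by (rule inj_onD[OF bij_betw_imp_inj_on[OF g[of "p u" "q u"]] eq(3)]) (use uv eq in auto)
  qed
  moreover have "f ` ?V = cells ?A"
  proof (intro subset_antisym subsetI)
    fix x assume "x \<in> f ` ?V"
    then obtain v where v: "v \<in> ?V" "x = f v" by blast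
    then show "x \<in> cells ?A"
      using range[OF v(1)] bij_betwE[OF g[of "p v" "q v"]] by (simp add: f_def cells_def)
  next
    fix x assume "x \<in> cells ?A"
    then obtain i j t where x: "x = (i, j, t)" "i < k" "j < k" "t < card (?cell i j)"
      by (auto simp: cells_def)
    then have "t \<in> g i j ` ?cell i j"
      using g[of i j] by (auto simp: bij_betw_def)
    then obtain v where "v \<in> ?cell i j" "t = g i j v" by blast
    then have "x = f v" "v \<in> ?V" using x(1) by (simp_all add: f_def)
    then show "x \<in> f ` ?V" by blast
  qed
  ultimately have bij: "bij_betw f ?V (cells ?A)"
    by (simp add: bij_betw_def)
  have "{u, v} \<in> edges G \<longleftrightarrow> {f u, f v} \<in> edges (matrix_graph ?A)" if "u \<in> ?V" "v \<in> ?V" for u v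
  proof -
    have "f u \<in> cells ?A" "f v \<in> cells ?A"
      using bij_betwE[OF bij] that by auto
    then have "{f u, f v} \<in> edges (matrix_graph ?A) \<longleftrightarrow> p u \<noteq> p v \<and> q u \<noteq> q v"
      by (simp add: matrix_graph_eq edge_bicolored_graph) (simp add: f_def)
    moreover have "{u, v} \<notin> edges G \<longleftrightarrow> (u, v) \<in> nonadj G"
      using that by (simp add: nonadj_def)
    ultimately show ?thesis
      using that by (auto simp: assms(2) nonadj_bicolored_graph)
  qed
  then show ?thesis
    unfolding graph_iso_def verts_matrix_graph using bij by blast
qed

text \<open>Rows and columns are the two colorings; \<open>(i, i, 0)\<close> and
  \<open>(i, j, 0)\<close> share a row but no column.\<close>

lemma ambiguously_colorable_matrix_graph:
  assumes "A \<in> carrier_mat k k" and "i < k" and "j < k" and "i \<noteq> j"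
    and "A $$ (i, i) \<noteq> 0" and "A $$ (i, j) \<noteq> 0"
  shows "ambiguously_colorable k (matrix_graph A)"
proof -
  have range: "fst \<in> cells A \<rightarrow> {..<k}" "fst \<circ> snd \<in> cells A \<rightarrow> {..<k}"
    using assms(1) by (auto simp: cells_def)
  have "(i, i, 0) \<in> cells A" "(i, j, 0) \<in> cells A"
    using assms by (auto simp: cells_def)
  moreover have "fst (i, i, 0 :: nat) = fst (i, j, 0 :: nat)" "(fst \<circ> snd) (i, i, 0 :: nat) \<noteq> (fst \<circ> snd) (i, j, 0 :: nat)"
    using assms(4) by simp_all
  ultimately have "\<exists>u\<in>cells A. \<exists>v\<in>cells A. fst u = fst v \<and> (fst \<circ> snd) u \<noteq> (fst \<circ> snd) v"
    by blast
  then show ?thesis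
    unfolding ambiguously_colorable_iff[OF simple_matrix_graph] verts_matrix_graph
    using range proper_bicolored_graph[of "cells A" fst "fst \<circ> snd", folded matrix_graph_eq] by blast
qed

text \<open>A value below m would force all values to be at most m and the sum below k m; a value
  above m + 1 would force all values to be at least m + 1 and the sum to reach k (m + 1).\<close>

lemma balanced_sum_values:
  fixes f :: "nat \<Rightarrow> nat"
  assumes "\<And>i i'. i < k \<Longrightarrow> i' < k \<Longrightarrow> f i \<le> f i' + 1" and "i < k"
  defines "m \<equiv> (\<Sum>l<k. f l) div k"
  shows "f i = m \<or> f i = m + 1"
proof -
  let ?n = "\<Sum>l<k. f l"
  have n: "k * m \<le> ?n" "?n < k * (m + 1)"
    unfolding m_def using assms(2) dividend_less_times_div[of k ?n] by (auto simp: mult_Suc_right)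
  have "f i \<ge> m"
  proof (rule ccontr)
    assume "\<not> ?thesis"
    then have "f l \<le> m" if "l < k" for l
      using assms(1)[OF that assms(2)] by simp
    then have "?n < (\<Sum>l<k. m)"
      using assms(2) \<open>\<not> m \<le> f i\<close> by (intro sum_strict_mono_ex1) (auto intro!: bexI[of _ i])
    with n show False by simp
  qed
  moreover have "f i \<le> m + 1"
  proof (rule ccontr)
    assume *: "\<not> ?thesis"
    have "m + 1 \<le> f l" if "l < k" for l
      using assms(1)[OF assms(2) that] * by simp
    then have "(\<Sum>l<k. m + 1) \<le> ?n"
      by (intro sum_mono) simp
    with n show False by simp
  qed
  ultimately show ?thesis by linarith
qed

section \<open>Optimal special matrices\<close>

text \<open>Equality in \<open>ambiguous_lower_bound\<close>, as a property of the matrix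
  alone.\<close>

definition optimal :: "nat mat \<Rightarrow> bool" where
  "optimal A \<longleftrightarrow> int (card (nonadj (matrix_graph A)))
    = min_sq (sum_mat A) (dim_row A) + 2 * int (max 1 (sum_mat A div dim_row A))"

lemma special_at_row_sum:
  assumes "A \<in> carrier_mat k k" and "special_at A i j" and "a < k"
  shows "row_sum A a = A $$ (a, a) + (if a = i then 1 else 0)"
proof -
  have "A $$ (a, b) = (if b = a then A $$ (a, b) else 0) + (if b = j then if a = i then 1 else 0 else 0)"
    if "b < k" for b
    using assms that by (auto simp: special_at_def)
  then have "row_sum A a = (\<Sum>b<k. (if b = a then A $$ (a, b) else 0) + (if b = j then if a = i then 1 else 0 else 0))"
    using assms(1) by (auto simp: row_sum_def intro!: sum.cong)
  then show ?thesis
    using assms unfolding sum.distrib by (auto simp: special_at_def)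
qed

lemma special_at_transpose:
  assumes "A \<in> carrier_mat k k"
  shows "special_at (transpose_mat A) j i \<longleftrightarrow> special_at A i j"
  using assms unfolding special_at_def by (auto; blast)

text \<open>Columns are rows of the transpose, where \<open>i\<close> and \<open>j\<close> change
  places.\<close>

lemma special_at_col_sum:
  assumes "A \<in> carrier_mat k k" and "special_at A i j" and "a < k"
  shows "col_sum A a = A $$ (a, a) + (if a = j then 1 else 0)"
proof -
  have "col_sum A a = row_sum (transpose_mat A) a"
    using assms(1,3) by (auto simp: row_sum_def col_sum_def intro!: sum.cong)
  also have "\<dots> = A $$ (a, a) + (if a = j then 1 else 0)"
    using special_at_row_sum[of "transpose_mat A" k j i a] assms special_at_transpose[OF assms(1)] by auto
  finally show ?thesis .
qed

text \<open>The sum of row \<open>i\<close> is raised by the off-diagonal one, so its gap is y i (y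
  i + 1). The column squares exceed the entry squares by twice the diagonal entry at
  \<open>j\<close>; with the gap of row \<open>j\<close> this makes 2 m + y j (y j + 1).\<close>

lemma special_at_card_nonadj:
  assumes "A \<in> carrier_mat k k" and "special_at A i j"
  defines "m \<equiv> sum_mat A div k" and "y \<equiv> \<lambda>l. int (A $$ (l, l)) - int (sum_mat A div k)"
  shows "int (card (nonadj (matrix_graph A))) = min_sq (sum_mat A) k + 2 * int m
    + y i * (y i + 1) + y j * (y j + 1) + (\<Sum>l\<in>{..<k} - {i, j}. gap m (A $$ (l, l)))"
proof -
  let ?d = "\<lambda>l. A $$ (l, l)"
  have ij: "i < k" "j < k" "i \<noteq> j"
    using assms(1,2) by (auto simp: special_at_def)
  have dims: "dim_row A = k" "dim_col A = k" using assms(1) by auto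
  have entries: "(\<Sum>a<k. \<Sum>b<k. (A $$ (a, b))\<^sup>2) = (\<Sum>a<k. (?d a)\<^sup>2) + 1"
  proof -
    have "(\<Sum>b<k. (A $$ (a, b))\<^sup>2) = (?d a)\<^sup>2 + (if a = i then 1 else 0)" if "a < k" for a
    proof -
      have "(\<Sum>b<k. (A $$ (a, b))\<^sup>2)
          = (\<Sum>b<k. (if b = a then (A $$ (a, b))\<^sup>2 else 0) + (if b = j then if a = i then 1 else 0 else 0))"
        using assms(1,2) that by (intro sum.cong) (auto simp: special_at_def)
      then show ?thesis using ij that unfolding sum.distrib by auto
    qed
    then show ?thesis using ij by (simp add: sum.distrib)
  qed
  have square_shift: "(\<Sum>a<k. (?d a + (if a = l then 1 else 0))\<^sup>2) = (\<Sum>a<k. (?d a)\<^sup>2) + 2 * ?d l + 1"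
    if "l < k" for l
  proof -
    have "(?d a + (if a = l then 1 else 0))\<^sup>2 = (?d a)\<^sup>2 + (if a = l then 2 * ?d a + 1 else 0)" for a
      by (simp add: power2_eq_square)
    then show ?thesis using that by (simp add: sum.distrib)
  qed
  have rows: "(\<Sum>a<k. (row_sum A a)\<^sup>2) = (\<Sum>a<k. (?d a)\<^sup>2) + 2 * ?d i + 1"
    using special_at_row_sum[OF assms(1,2)] square_shift[OF ij(1)] by simp
  have cols: "(\<Sum>a<k. (col_sum A a)\<^sup>2) = (\<Sum>a<k. (?d a)\<^sup>2) + 2 * ?d j + 1"
    using special_at_col_sum[OF assms(1,2)] square_shift[OF ij(2)] by simp
  \<comment> \<open>The off-diagonal one adds 1 both to the column squares and to the entry
    squares.\<close>
  have "card (nonadj (matrix_graph A)) = (\<Sum>a<k. (row_sum A a)\<^sup>2) + 2 * ?d j"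
    using card_nonadj_matrix_graph[of A] entries rows cols unfolding dims by simp
  then have "int (card (nonadj (matrix_graph A))) = (\<Sum>a<k. int (row_sum A a) ^ 2) + 2 * int (?d j)"
    by simp
  also have "(\<Sum>a<k. int (row_sum A a) ^ 2) = min_sq (sum_mat A) k + (\<Sum>a<k. gap m (row_sum A a))"
    unfolding m_def by (intro sum_squares_eq) (simp_all add: sum_mat_eq dims)
  also have "(\<Sum>a<k. gap m (row_sum A a)) = gap m (row_sum A i) + (gap m (row_sum A j)
      + (\<Sum>a\<in>{..<k} - {i} - {j}. gap m (row_sum A a)))"
    using ij by (simp add: sum.remove[of _ i] sum.remove[of _ j])
  also have "{..<k} - {i} - {j} = {..<k} - {i, j}" by auto
  also have "(\<Sum>a\<in>{..<k} - {i, j}. gap m (row_sum A a)) = (\<Sum>a\<in>{..<k} - {i, j}. gap m (?d a))"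
    by (intro sum.cong) (auto simp: special_at_row_sum[OF assms(1,2)])
  finally show ?thesis
    using gap_plus[of m "?d j"] special_at_row_sum[OF assms(1,2)] ij
    by (simp add: gap_def y_def m_def algebra_simps)
qed

lemma mult_succ_eq_0: "(x :: int) * (x + 1) = 0 \<longleftrightarrow> x = 0 \<or> x = -1"
  by auto

lemma special_at_sum_mat_ge:
  assumes "A \<in> carrier_mat k k" and "special_at A i j"
  shows "k \<le> sum_mat A"
proof -
  have dims: "dim_row A = k" using assms(1) by auto
  have "(\<Sum>a<k. 1) \<le> (\<Sum>a<k. row_sum A a)"
    using assms by (intro sum_mono) (auto simp: special_at_row_sum[OF assms] special_at_def Suc_le_eq)
  then show ?thesis by (simp add: sum_mat_eq dims)
qed

text \<open>The terms beyond the bound in \<open>special_at_card_nonadj\<close> are all nonnegative,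
  so equality makes each of them vanish. Since \<open>m\<close> is positive, the maximum in
  \<open>optimal\<close> is \<open>m\<close>.\<close>

lemma special_at_optimal_iff:
  assumes "A \<in> carrier_mat k k" and "special_at A i j"
  defines "m \<equiv> sum_mat A div k"
  shows "optimal A \<longleftrightarrow> (A $$ (i, i) + 1 = m \<or> A $$ (i, i) = m) \<and> (A $$ (j, j) + 1 = m \<or> A $$ (j, j) = m) \<and>
    (\<forall>l<k. l \<noteq> i \<and> l \<noteq> j \<longrightarrow> A $$ (l, l) = m \<or> A $$ (l, l) = m + 1)"
proof -
  have k: "k > 0" "dim_row A = k" using assms(1,2) by (auto simp: special_at_def)
  let ?y = "\<lambda>l. int (A $$ (l, l)) - int m"
  let ?s = "\<Sum>l\<in>{..<k} - {i, j}. gap m (A $$ (l, l))"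
  have "m \<ge> 1"
    using special_at_sum_mat_ge[OF assms(1,2)] k div_greater_zero_iff[of "sum_mat A" k]
    by (simp add: m_def Suc_le_eq)
  then have "optimal A \<longleftrightarrow> ?y i * (?y i + 1) + ?y j * (?y j + 1) + ?s = 0"
    unfolding optimal_def special_at_card_nonadj[OF assms(1,2)] k(2) m_def[symmetric]
    by (simp add: max_def add.assoc)
  moreover have "?s \<ge> 0" by (simp add: sum_nonneg gap_nonneg)
  ultimately have "optimal A \<longleftrightarrow> ?y i * (?y i + 1) = 0 \<and> ?y j * (?y j + 1) = 0 \<and> ?s = 0"
    using mult_succ_nonneg[of "?y i"] mult_succ_nonneg[of "?y j"] by linarith
  also have "?s = 0 \<longleftrightarrow> (\<forall>l\<in>{..<k} - {i, j}. gap m (A $$ (l, l)) = 0)"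
    using gap_nonneg by (intro sum_nonneg_eq_0_iff) auto
  also have "?y i * (?y i + 1) = 0 \<longleftrightarrow> A $$ (i, i) + 1 = m \<or> A $$ (i, i) = m"
    unfolding mult_succ_eq_0 by arith
  also have "?y j * (?y j + 1) = 0 \<longleftrightarrow> A $$ (j, j) + 1 = m \<or> A $$ (j, j) = m"
    unfolding mult_succ_eq_0 by arith
  finally show ?thesis
    unfolding gap_eq_0_iff by auto
qed

text \<open>Balanced row sums are m or m + 1, and removing the off-diagonal one from row
  \<open>i\<close> leaves m - 1 or m. Type (b) is the same with columns; type (c) meets the
  conditions directly.\<close>

lemma very_special_optimal:
  assumes A: "A \<in> carrier_mat k k" and "very_special A"
  shows "optimal A"
proof -
  have dims: "dim_row A = k" "dim_col A = k" using A by auto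
  define m where "m = sum_mat A div k"
  from assms(2) consider "a_special A" | "b_special A" | "c_special A"
    by (auto simp: very_special_def)
  then show ?thesis
  proof cases
    case 1
    then obtain i j where s: "special_at A i j" and b: "row_sum_balanced A" and j: "row_sum A j = m"
      by (auto simp: a_special_def dims m_def)
    have ij: "i < k" "j < k" "i \<noteq> j" using s dims by (auto simp: special_at_def)
    have "row_sum A l = m \<or> row_sum A l = m + 1" if "l < k" for l
      using balanced_sum_values[of k "row_sum A" l] b that
      by (simp add: row_sum_balanced_def dims m_def sum_mat_eq)
    note sums = this
    have vals: "A $$ (l, l) + (if l = i then 1 else 0) = m \<or>
        A $$ (l, l) + (if l = i then 1 else 0) = m + 1" if "l < k" for l
      using special_at_row_sum[OF A s that] sums[OF that] by simp
    have jj: "A $$ (j, j) = m"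
      using special_at_row_sum[OF A s, of j] ij j by simp
    then show ?thesis
      unfolding special_at_optimal_iff[OF A s] m_def[symmetric]
    proof (intro conjI allI impI)
      show "A $$ (i, i) + 1 = m \<or> A $$ (i, i) = m"
        using vals[of i] ij by auto
    next
      fix l assume "l < k" "l \<noteq> i \<and> l \<noteq> j"
      then show "A $$ (l, l) = m \<or> A $$ (l, l) = m + 1"
        using vals[of l] by auto
    qed (use jj in auto)
  next
    case 2
    then obtain i j where s: "special_at A i j" and b: "col_sum_balanced A" and i: "col_sum A i = m"
      by (auto simp: b_special_def dims m_def)
    have ij: "i < k" "j < k" "i \<noteq> j" using s dims by (auto simp: special_at_def)
    have "col_sum A l = m \<or> col_sum A l = m + 1" if "l < k" for l
      using balanced_sum_values[of k "col_sum A" l] b that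
      by (simp add: col_sum_balanced_def dims m_def sum_mat_eq_col)
    note sums = this
    have vals: "A $$ (l, l) + (if l = j then 1 else 0) = m \<or>
        A $$ (l, l) + (if l = j then 1 else 0) = m + 1" if "l < k" for l
      using special_at_col_sum[OF A s that] sums[OF that] by simp
    have ii: "A $$ (i, i) = m"
      using special_at_col_sum[OF A s, of i] ij i by simp
    then show ?thesis
      unfolding special_at_optimal_iff[OF A s] m_def[symmetric]
    proof (intro conjI allI impI)
      show "A $$ (j, j) + 1 = m \<or> A $$ (j, j) = m"
        using vals[of j] ij by auto
    next
      fix l assume "l < k" "l \<noteq> i \<and> l \<noteq> j"
      then show "A $$ (l, l) = m \<or> A $$ (l, l) = m + 1"
        using vals[of l] by auto
    qed (use ii in auto)
  next
    case 3
    then obtain i j where s: "special_at A i j" and "A $$ (i, i) + 1 = m" "A $$ (j, j) + 1 = m"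
      "\<forall>l<k. l \<noteq> i \<and> l \<noteq> j \<longrightarrow> A $$ (l, l) \<in> {m, m + 1}"
      by (auto simp: c_special_def Let_def dims m_def)
    then show ?thesis
      unfolding special_at_optimal_iff[OF A s] m_def[symmetric] by simp
  qed
qed

lemma two_values_le:
  fixes f :: "nat \<Rightarrow> nat"
  assumes "\<And>l. l < k \<Longrightarrow> f l = m \<or> f l = m + 1" and "a < k" and "b < k"
  shows "f a \<le> f b + 1"
  using assms(1)[OF assms(2)] assms(1)[OF assms(3)] by auto

text \<open>A diagonal entry m at \<open>j\<close> gives type (a); failing that, an entry m at
  \<open>i\<close> gives type (b). If both entries are m - 1, type (c) remains.\<close>

lemma special_at_very_special:
  assumes A: "A \<in> carrier_mat k k" and s: "special_at A i j" and "optimal A"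
  shows "very_special A"
proof -
  have dims: "dim_row A = k" "dim_col A = k" using A by auto
  define m where "m = sum_mat A div k"
  have ij: "i < k" "j < k" "i \<noteq> j" using s dims by (auto simp: special_at_def)
  have di: "A $$ (i, i) + 1 = m \<or> A $$ (i, i) = m" and dj: "A $$ (j, j) + 1 = m \<or> A $$ (j, j) = m"
    and dl: "\<And>l. l < k \<Longrightarrow> l \<noteq> i \<Longrightarrow> l \<noteq> j \<Longrightarrow> A $$ (l, l) = m \<or> A $$ (l, l) = m + 1"
    using assms(3) unfolding special_at_optimal_iff[OF A s] m_def[symmetric] by auto
  consider "A $$ (j, j) = m" | "A $$ (j, j) + 1 = m" "A $$ (i, i) = m"
    | "A $$ (j, j) + 1 = m" "A $$ (i, i) + 1 = m"
    using di dj by blast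
  then show ?thesis
  proof cases
    case 1
    have "row_sum A l = m \<or> row_sum A l = m + 1" if "l < k" for l
      using special_at_row_sum[OF A s that] di dl[OF that] 1 by auto
    note vals = this
    have "row_sum_balanced A"
      unfolding row_sum_balanced_def dims using two_values_le[where f = "row_sum A" and m = m, OF vals] by blast
    moreover have "row_sum A j = m" using special_at_row_sum[OF A s ij(2)] ij 1 by simp
    ultimately show ?thesis
      unfolding very_special_def a_special_def dims m_def[symmetric] using s by blast
  next
    case 2
    have "col_sum A l = m \<or> col_sum A l = m + 1" if "l < k" for l
      using special_at_col_sum[OF A s that] dl[OF that] 2 by auto
    note vals = this
    have "col_sum_balanced A"
      unfolding col_sum_balanced_def dims using two_values_le[where f = "col_sum A" and m = m, OF vals] by blast
    moreover have "col_sum A i = m" using special_at_col_sum[OF A s ij(1)] ij 2 by simp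
    ultimately show ?thesis
      unfolding very_special_def b_special_def dims m_def[symmetric] using s by blast
  next
    case 3
    \<comment> \<open>Otherwise no row sum exceeds m and that of row \<open>j\<close> is smaller, so
      the total would be less than k m.\<close>
    have "\<exists>l<k. A $$ (l, l) = m + 1"
    proof (rule ccontr)
      assume *: "\<not> ?thesis"
      have "row_sum A l \<le> m" if "l < k" for l
      proof -
        have "A $$ (l, l) \<noteq> m + 1" using * that by blast
        then show ?thesis
          using special_at_row_sum[OF A s that] 3 dl[OF that] by (cases "l = j") auto
      qed
      moreover have "row_sum A j < m" using special_at_row_sum[OF A s ij(2)] 3 ij by simp
      ultimately have "sum_mat A < (\<Sum>l<k. m)"
        unfolding sum_mat_eq dims using ij by (intro sum_strict_mono_ex1) auto
      then show False
        using times_div_less_eq_dividend[of k "sum_mat A"] by (simp add: m_def)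
    qed
    then show ?thesis
      unfolding very_special_def c_special_def Let_def dims m_def[symmetric] using s 3 dl by blast
  qed
qed

section \<open>Optimal normal, tiny and small matrices\<close>

text \<open>The block structure of a mininormal matrix by indices, in place of
  \<open>four_block_mat\<close>; \<open>optimal\<close> then supplies balance and the range of
  n.\<close>

definition twin_block :: "nat mat \<Rightarrow> bool" where
  "twin_block A \<longleftrightarrow> 2 \<le> dim_row A \<and> (\<forall>a<2. \<forall>b<2. A $$ (a, b) = 1) \<and>
     (\<forall>a<dim_row A. A $$ (a, a) \<noteq> 0) \<and>
     (\<forall>a<dim_row A. \<forall>b<dim_row A. a \<noteq> b \<and> \<not> (a < 2 \<and> b < 2) \<longrightarrow> A $$ (a, b) = 0)"

text \<open>For size 2 only \<open>s = 1\<close> occurs, and a zero submatrix would be a single zero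
  entry.\<close>

lemma fully_indecomposable_ones: "fully_indecomposable (mat 2 2 (\<lambda>_. 1))"
proof -
  have False if *: "I \<subseteq> {..<2}" "J \<subseteq> {..<2}" "card I = 1" "card J = 1"
    "\<forall>i\<in>I. \<forall>j\<in>J. mat 2 2 (\<lambda>_. 1 :: nat) $$ (i, j) = 0" for I J :: "nat set"
  proof -
    obtain i j where "I = {i}" "J = {j}"
      using *(3,4) by (metis card_1_singletonE)
    with * show False by simp
  qed
  note no_zero = this
  show ?thesis
    unfolding fully_indecomposable_def Let_def
  proof (rule notI, elim bexE exE conjE)
    fix s and I J :: "nat set"
    let ?M = "mat 2 2 (\<lambda>_. 1 :: nat)"
    assume "s \<in> {1..dim_row ?M - 1}" "I \<subseteq> {..<dim_row ?M}" "J \<subseteq> {..<dim_row ?M}"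
      "card I = s" "card J = dim_row ?M - s" "\<forall>i\<in>I. \<forall>j\<in>J. ?M $$ (i, j) = 0"
    then show False by (intro no_zero[of I J]) auto
  qed
qed

lemma normal_blocksE:
  assumes "normal_blocks A M D"
  obtains r d where "M \<in> carrier_mat r r" "D \<in> carrier_mat d d"
    "A = four_block_mat M (0\<^sub>m r d) (0\<^sub>m d r) D" "diagonal_mat D" "\<forall>i < d. D $$ (i, i) \<noteq> 0"
  using assms unfolding normal_blocks_def by blast

lemma normal_blocks_ones_iff:
  assumes "A \<in> carrier_mat k k"
  shows "(\<exists>D. normal_blocks A (mat 2 2 (\<lambda>_. 1)) D) \<longleftrightarrow> twin_block A"
proof
  have k: "dim_row A = k" "dim_col A = k" using assms by auto
  let ?M = "mat 2 2 (\<lambda>_. 1) :: nat mat"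
  assume "\<exists>D. normal_blocks A ?M D"
  then obtain D where "normal_blocks A ?M D" ..
  then obtain r d where *: "?M \<in> carrier_mat r r" "D \<in> carrier_mat d d"
    "A = four_block_mat ?M (0\<^sub>m r d) (0\<^sub>m d r) D" "diagonal_mat D" "\<forall>i < d. D $$ (i, i) \<noteq> 0"
    by (rule normal_blocksE)
  have r: "r = 2" using carrier_matD(1)[OF *(1)] by (simp only: dim_row_mat)
  have d: "dim_row D = d" "dim_col D = d" using *(2) by auto
  have kd: "k = 2 + d" using *(3) k d by simp
  have entry: "A $$ (a, b) = (if a < 2 then if b < 2 then 1 else 0
      else if b < 2 then 0 else D $$ (a - 2, b - 2))" if "a < k" "b < k" for a b
  proof -
    have "A $$ (a, b) = four_block_mat ?M (0\<^sub>m 2 d) (0\<^sub>m d 2) D $$ (a, b)"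
      by (rule arg_cong[where f = "\<lambda>X. X $$ (a, b)"]) (use *(3) in \<open>simp only: r\<close>)
    also have "\<dots> = (if a < 2 then if b < 2 then 1 else 0 else if b < 2 then 0 else D $$ (a - 2, b - 2))"
      using that by (subst index_mat_four_block(1)) (auto simp: d kd)
    finally show ?thesis .
  qed
  show "twin_block A"
    unfolding twin_block_def k
  proof (intro conjI allI impI)
    fix a b assume "a < k" "b < k" "a \<noteq> b \<and> \<not> (a < 2 \<and> b < 2)"
    then show "A $$ (a, b) = 0"
      using *(4) entry[of a b] by (auto simp: diagonal_mat_def d kd)
  next
    fix a assume "a < k"
    then show "A $$ (a, a) \<noteq> 0"
      using *(5) entry[of a a] by (auto simp: kd)
  next
    fix a b :: nat assume "a < 2" "b < 2"
    then show "A $$ (a, b) = 1"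
      using entry[of a b] by (simp add: kd)
  qed (simp add: kd)
next
  have k: "dim_row A = k" "dim_col A = k" using assms by auto
  let ?M = "mat 2 2 (\<lambda>_. 1) :: nat mat"
  assume tw: "twin_block A"
  then have k2: "2 \<le> k" by (simp add: twin_block_def k)
  \<comment> \<open>The part of \<open>A\<close> beyond its first two rows and columns.\<close>
  define D where "D = mat (k - 2) (k - 2) (\<lambda>(a, b). A $$ (a + 2, b + 2))"
  have shift: "Suc (Suc (a - 2)) = a" if "\<not> a < 2" for a
    using that by arith
  have "A = four_block_mat ?M (0\<^sub>m 2 (k - 2)) (0\<^sub>m (k - 2) 2) D"
  proof (rule eq_matI)
    fix a b
    assume "a < dim_row (four_block_mat ?M (0\<^sub>m 2 (k - 2)) (0\<^sub>m (k - 2) 2) D)"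
      "b < dim_col (four_block_mat ?M (0\<^sub>m 2 (k - 2)) (0\<^sub>m (k - 2) 2) D)"
    then have "a < k" "b < k" using k2 by (simp_all add: D_def)
    then show "A $$ (a, b) = four_block_mat ?M (0\<^sub>m 2 (k - 2)) (0\<^sub>m (k - 2) 2) D $$ (a, b)"
      using tw k2 by (auto simp: twin_block_def k D_def shift)
  qed (use k2 in \<open>simp_all add: k D_def\<close>)
  moreover have "diagonal_mat D" "\<forall>i<k - 2. D $$ (i, i) \<noteq> 0"
    using tw by (auto simp: diagonal_mat_def D_def twin_block_def k)
  moreover have "D \<in> carrier_mat (k - 2) (k - 2)" by (simp add: D_def)
  moreover have "?M \<in> carrier_mat 2 2" "\<forall>i<2. ?M $$ (i, i) \<noteq> 0" "(2 :: nat) \<le> 2"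
    by auto
  ultimately show "\<exists>D. normal_blocks A ?M D"
    unfolding normal_blocks_def using fully_indecomposable_ones by blast
qed

lemma sum_first_two: "2 \<le> k \<Longrightarrow> (\<Sum>a<k. if a < 2 then c else 0) = 2 * (c :: nat)"
  for k :: nat
  using sum.inter_restrict[of "{..<k}" "\<lambda>_. c" "{..<2}"] by (simp add: Int_absorb1)

lemma twin_block_row_sum:
  assumes "A \<in> carrier_mat k k" and "twin_block A" and "a < k"
  shows "row_sum A a = A $$ (a, a) + (if a < 2 then 1 else 0)"
proof -
  \<comment> \<open>For a < 2 the index \<open>1 - a\<close> is the other index of the block. For
    larger a truncated subtraction gives 0, where the inner condition contributes nothing.\<close>
  have "row_sum A a = (\<Sum>b<k. (if b = a then A $$ (a, a) else 0) + (if b = 1 - a then if a < 2 then 1 else 0 else 0))"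
    using assms unfolding row_sum_def twin_block_def
    by (intro sum.cong) (auto simp: less_2_cases_iff)
  then show ?thesis
    using assms unfolding sum.distrib by (auto simp: twin_block_def)
qed

lemma twin_block_col_sum:
  assumes "A \<in> carrier_mat k k" and "twin_block A" and "a < k"
  shows "col_sum A a = row_sum A a"
proof -
  have "A $$ (b, a) = A $$ (a, b)" if "b < k" for b
  proof (cases "a = b \<or> a < 2 \<and> b < 2")
    case True
    then show ?thesis using assms(2) by (auto simp: twin_block_def)
  next
    case False
    then have "A $$ (a, b) = 0" "A $$ (b, a) = 0"
      using assms that unfolding twin_block_def by (metis carrier_matD(1))+
    then show ?thesis by simp
  qed
  then show ?thesis
    using assms(1) by (auto simp: row_sum_def col_sum_def intro!: sum.cong)
qed

text \<open>The first two rows have diagonal entry 1 and sum 2, so each exceeds its diagonal square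
  by 3, and columns behave alike. The entry squares contain two off-diagonal ones, so the column
  squares exceed them by 6 - 2 = 4.\<close>

lemma twin_block_card_nonadj:
  assumes "A \<in> carrier_mat k k" and "twin_block A"
  shows "int (card (nonadj (matrix_graph A)))
    = min_sq (sum_mat A) k + (\<Sum>a<k. gap (sum_mat A div k) (row_sum A a)) + 4"
proof -
  let ?d = "\<lambda>a. A $$ (a, a)"
  have dims: "dim_row A = k" "dim_col A = k" using assms(1) by auto
  have k2: "2 \<le> k" using assms by (auto simp: twin_block_def)
  have "(\<Sum>b<k. (A $$ (a, b))\<^sup>2) = (?d a)\<^sup>2 + (if a < 2 then 1 else 0)" if "a < k" for a
  proof -
    have "(\<Sum>b<k. (A $$ (a, b))\<^sup>2)
        = (\<Sum>b<k. (if b = a then (?d a)\<^sup>2 else 0) + (if b = 1 - a then if a < 2 then 1 else 0 else 0))"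
      using assms that unfolding twin_block_def by (intro sum.cong) (auto simp: less_2_cases_iff)
    then show ?thesis using k2 that unfolding sum.distrib by auto
  qed
  then have entries: "(\<Sum>a<k. \<Sum>b<k. (A $$ (a, b))\<^sup>2) = (\<Sum>a<k. (?d a)\<^sup>2) + 2"
    using sum_first_two[OF k2, of 1] by (simp add: sum.distrib)
  have "(row_sum A a)\<^sup>2 = (?d a)\<^sup>2 + (if a < 2 then 3 else 0)" if "a < k" for a
    using twin_block_row_sum[OF assms that] assms(2) by (auto simp: twin_block_def power2_eq_square)
  then have rows: "(\<Sum>a<k. (row_sum A a)\<^sup>2) = (\<Sum>a<k. (?d a)\<^sup>2) + 6"
    using sum_first_two[OF k2, of 3] by (simp add: sum.distrib)
  moreover have "(\<Sum>a<k. (col_sum A a)\<^sup>2) = (\<Sum>a<k. (row_sum A a)\<^sup>2)"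
    using twin_block_col_sum[OF assms] by simp
  ultimately have "card (nonadj (matrix_graph A)) = (\<Sum>a<k. (row_sum A a)\<^sup>2) + 4"
    using card_nonadj_matrix_graph[of A] entries unfolding dims by simp
  then have "int (card (nonadj (matrix_graph A))) = (\<Sum>a<k. int (row_sum A a) ^ 2) + 4"
    by simp
  also have "(\<Sum>a<k. int (row_sum A a) ^ 2)
      = min_sq (sum_mat A) k + (\<Sum>a<k. gap (sum_mat A div k) (row_sum A a))"
    by (intro sum_squares_eq) (simp_all add: sum_mat_eq dims)
  finally show ?thesis by simp
qed

text \<open>Optimality says that the gaps plus 4 equal 2 m. The two rows of sum 2 alone contribute 2
  (m - 1) (m - 2), which leaves (m - 2)^2 \<le> 0. Hence m = 2, which is the range of n, and all
  gaps vanish, which is balance.\<close>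

lemma twin_block_optimal_iff:
  assumes "A \<in> carrier_mat k k" and "twin_block A"
  shows "optimal A \<longleftrightarrow> balanced A \<and> 2 * k \<le> sum_mat A \<and> sum_mat A < 3 * k"
proof -
  have dims: "dim_row A = k" "dim_col A = k" using assms(1) by auto
  have k2: "2 \<le> k" using assms by (auto simp: twin_block_def)
  define m where "m = sum_mat A div k"
  let ?gaps = "\<Sum>a<k. gap m (row_sum A a)"
  have "(\<Sum>a<k. 1) \<le> (\<Sum>a<k. row_sum A a)"
    using assms by (intro sum_mono) (auto simp: twin_block_row_sum[OF assms] twin_block_def Suc_le_eq)
  then have "m \<ge> 1"
    using k2 div_greater_zero_iff[of "sum_mat A" k] by (simp add: m_def sum_mat_eq dims Suc_le_eq)
  then have opt: "optimal A \<longleftrightarrow> ?gaps + 4 = 2 * int m"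
    unfolding optimal_def twin_block_card_nonadj[OF assms] dims m_def[symmetric]
    by (simp add: max_def)
  have m2: "m = 2 \<longleftrightarrow> 2 * k \<le> sum_mat A \<and> sum_mat A < 3 * k"
  proof
    assume "m = 2"
    then show "2 * k \<le> sum_mat A \<and> sum_mat A < 3 * k"
      using k2 times_div_less_eq_dividend[of k "sum_mat A"] dividend_less_times_div[of k "sum_mat A"]
      by (simp add: m_def)
  next
    assume "2 * k \<le> sum_mat A \<and> sum_mat A < 3 * k"
    then show "m = 2" unfolding m_def by (intro div_nat_eqI) auto
  qed
  show ?thesis
  proof
    assume "optimal A"
    then have eq: "?gaps + 4 = 2 * int m" using opt by simp
    have R: "row_sum A 0 = 2" "row_sum A 1 = 2"
      using twin_block_row_sum[OF assms] assms(2) k2 by (auto simp: twin_block_def)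
    have "(\<Sum>a\<in>{0, 1}. gap m (row_sum A a)) \<le> ?gaps"
      using k2 gap_nonneg by (intro sum_mono2) auto
    then have "2 * gap m 2 + 4 \<le> 2 * int m" using eq R by simp
    then have "(int m - 2) * (int m - 2) \<le> 0"
      by (simp add: gap_def algebra_simps)
    then have "int m - 2 = 0"
      by (metis mult_eq_0_iff order_antisym zero_le_square)
    then have m: "m = 2" by simp
    then have "?gaps = 0" using eq by simp
    then have "\<forall>a\<in>{..<k}. gap m (row_sum A a) = 0"
      using gap_nonneg by (subst (asm) sum_nonneg_eq_0_iff) auto
    then have vals: "row_sum A a = m \<or> row_sum A a = m + 1" if "a < k" for a
      using that unfolding gap_eq_0_iff by blast
    have "row_sum_balanced A"
      unfolding row_sum_balanced_def dims using two_values_le[where f = "row_sum A" and m = m, OF vals] by blast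
    moreover from this have "col_sum_balanced A"
      by (simp add: row_sum_balanced_def col_sum_balanced_def dims twin_block_col_sum[OF assms])
    ultimately show "balanced A \<and> 2 * k \<le> sum_mat A \<and> sum_mat A < 3 * k"
      using m m2 by (simp add: balanced_def)
  next
    assume *: "balanced A \<and> 2 * k \<le> sum_mat A \<and> sum_mat A < 3 * k"
    then have b: "\<And>i i'. i < k \<Longrightarrow> i' < k \<Longrightarrow> row_sum A i \<le> row_sum A i' + 1"
      by (simp add: balanced_def row_sum_balanced_def dims)
    have "gap m (row_sum A a) = 0" if "a < k" for a
      using balanced_sum_values[of k "row_sum A" a, OF b that]
      unfolding gap_eq_0_iff m_def sum_mat_eq dims by blast
    then have "?gaps = 0" by simp
    then show "optimal A" using opt m2 * by simp
  qed
qed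

lemma mininormal_iff:
  assumes "A \<in> carrier_mat k k"
  shows "mininormal A \<longleftrightarrow> twin_block A \<and> optimal A"
proof -
  have dims: "dim_row A = k" using assms by auto
  have "mininormal A \<longleftrightarrow> twin_block A \<and> balanced A \<and> 2 * k \<le> sum_mat A \<and> sum_mat A < 3 * k"
    unfolding mininormal_def normal_blocks_ones_iff[OF assms, symmetric] dims by blast
  then show ?thesis
    using twin_block_optimal_iff[OF assms] by blast
qed

section \<open>Diagonal matrices with entries at most 2\<close>

lemma diagonal_mat_row_sum:
  assumes "A \<in> carrier_mat k k" and "diagonal_mat A" and "a < k"
  shows "row_sum A a = A $$ (a, a)" and "col_sum A a = A $$ (a, a)"
    and "(\<Sum>b<k. (A $$ (a, b))\<^sup>2) = (A $$ (a, a))\<^sup>2"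
proof -
  \<comment> \<open>The identity and the square as \<open>f\<close> yield the line sums and the sum
    of squares.\<close>
  have "(\<Sum>b<k. f (A $$ (a, b))) = f (A $$ (a, a))" "(\<Sum>b<k. f (A $$ (b, a))) = f (A $$ (a, a))"
    if "f 0 = 0" for f :: "nat \<Rightarrow> nat"
  proof -
    have "(\<Sum>b<k. f (A $$ (a, b))) = (\<Sum>b<k. if b = a then f (A $$ (a, a)) else 0)"
      "(\<Sum>b<k. f (A $$ (b, a))) = (\<Sum>b<k. if b = a then f (A $$ (a, a)) else 0)"
      by (intro sum.cong; use assms that in \<open>auto simp: diagonal_mat_def\<close>)+
    then show "(\<Sum>b<k. f (A $$ (a, b))) = f (A $$ (a, a))" "(\<Sum>b<k. f (A $$ (b, a))) = f (A $$ (a, a))"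
      using assms(3) by simp_all
  qed
  from this[of "\<lambda>x. x"] this[of "\<lambda>x. x\<^sup>2"] show "row_sum A a = A $$ (a, a)"
    "col_sum A a = A $$ (a, a)" "(\<Sum>b<k. (A $$ (a, b))\<^sup>2) = (A $$ (a, a))\<^sup>2"
    using assms(1) by (auto simp: row_sum_def col_sum_def)
qed

lemma card_eq_sum_indicator: "card {a. a < k \<and> P a} = (\<Sum>a<k. if P a then 1 else 0)" for k :: nat
  using sum.inter_filter[of "{..<k}" "\<lambda>_. 1 :: nat" P] by simp

text \<open>An entry d in {0, 1, 2} satisfies d + [d = 0] = 1 + [d = 2] and d^2 = d + 2 [d = 2];
  both are summed over the diagonal.\<close>

lemma diagonal_counts:
  assumes "A \<in> carrier_mat k k" and "diagonal_mat A" and "\<And>a. a < k \<Longrightarrow> A $$ (a, a) \<le> 2"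
  defines "twos \<equiv> card {a. a < k \<and> A $$ (a, a) = 2}" and "zeros \<equiv> card {a. a < k \<and> A $$ (a, a) = 0}"
  shows "sum_mat A + zeros = k + twos"
    and "card (nonadj (matrix_graph A)) = sum_mat A + 2 * twos"
proof -
  let ?d = "\<lambda>a. A $$ (a, a)"
  have dims: "dim_row A = k" "dim_col A = k" using assms(1) by auto
  have n: "sum_mat A = (\<Sum>a<k. ?d a)"
    using diagonal_mat_row_sum(1)[OF assms(1,2)] by (simp add: sum_mat_eq dims)
  have d: "?d a = 0 \<or> ?d a = 1 \<or> ?d a = 2" if "a < k" for a
    using assms(3)[OF that] by auto
  have "sum_mat A + zeros = (\<Sum>a<k. ?d a + (if ?d a = 0 then 1 else 0))"
    by (simp add: n zeros_def card_eq_sum_indicator sum.distrib)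
  also have "\<dots> = (\<Sum>a<k. 1 + (if ?d a = 2 then 1 else 0))"
    using d by (intro sum.cong) fastforce+
  also have "\<dots> = k + twos"
    unfolding twos_def card_eq_sum_indicator sum.distrib by simp
  finally show "sum_mat A + zeros = k + twos" .
  have "card (nonadj (matrix_graph A)) = (\<Sum>a<k. (?d a)\<^sup>2)"
    using card_nonadj_matrix_graph[of A] unfolding dims
    by (simp add: diagonal_mat_row_sum[OF assms(1,2)])
  also have "\<dots> = (\<Sum>a<k. ?d a + 2 * (if ?d a = 2 then 1 else 0))"
    using d by (intro sum.cong) fastforce+
  also have "\<dots> = sum_mat A + 2 * twos"
    unfolding n twos_def card_eq_sum_indicator sum.distrib sum_distrib_left ..
  finally show "card (nonadj (matrix_graph A)) = sum_mat A + 2 * twos" .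
qed

lemma min_sq_less: "n < k \<Longrightarrow> min_sq n k = int n"
  by (simp add: min_sq_def)

lemma div_eq_1: "k \<le> n \<Longrightarrow> n < 2 * k \<Longrightarrow> n div k = 1" for n k :: nat
  by (intro div_nat_eqI) auto

lemma min_sq_div_1:
  assumes "k \<le> n" and "n < 2 * k"
  shows "min_sq n k = int k + 3 * (int n - int k)"
proof -
  have "n mod k = n - k" using assms by (simp add: mod_if)
  then show ?thesis using assms by (simp add: min_sq_def div_eq_1 of_nat_diff)
qed

lemma tiny_iff:
  assumes "A \<in> carrier_mat k k"
  shows "tiny A \<longleftrightarrow> diagonal_mat A \<and> (\<forall>a<k. A $$ (a, a) \<le> 2) \<and>
    card {a. a < k \<and> A $$ (a, a) = 2} = 1 \<and> 2 \<le> card {a. a < k \<and> A $$ (a, a) = 0}"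
proof -
  have "(x \<noteq> 2 \<longrightarrow> x \<le> 1) \<longleftrightarrow> x \<le> 2" for x :: nat by auto
  then show ?thesis using assms by (auto simp: tiny_def)
qed

lemma small_iff:
  assumes "A \<in> carrier_mat k k"
  shows "small A \<longleftrightarrow> diagonal_mat A \<and> (\<forall>a<k. A $$ (a, a) \<le> 2) \<and>
    1 \<le> card {a. a < k \<and> A $$ (a, a) = 2} \<and> card {a. a < k \<and> A $$ (a, a) = 0} = 1"
proof -
  have "(\<exists>a<k. A $$ (a, a) = 2) \<longleftrightarrow> 1 \<le> card {a. a < k \<and> A $$ (a, a) = 2}"
    by (auto simp: Suc_le_eq card_gt_0_iff)
  then show ?thesis using assms by (auto simp: small_def)
qed

text \<open>A tiny matrix has n < k and, with its single 2, n + 2 nonadjacent pairs. In a small one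
  the single zero makes the number of twos n - k + 1, which is below k; so n < 2 k, and there are 3
  n - 2 k + 2 pairs.\<close>

lemma tiny_or_small_optimal:
  assumes A: "A \<in> carrier_mat k k" and "tiny A \<or> small A"
  shows "optimal A"
proof -
  have dims: "dim_row A = k" using A by auto
  let ?h = "card {a. a < k \<and> A $$ (a, a) = 2}" and ?z = "card {a. a < k \<and> A $$ (a, a) = 0}"
  have d: "diagonal_mat A" "\<And>a. a < k \<Longrightarrow> A $$ (a, a) \<le> 2" and hz: "(?h = 1 \<and> 2 \<le> ?z) \<or> (1 \<le> ?h \<and> ?z = 1)"
    using assms(2) unfolding tiny_iff[OF A] small_iff[OF A] by auto
  note counts = diagonal_counts[OF A d]
  from hz show ?thesis
  proof
    assume "?h = 1 \<and> 2 \<le> ?z"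
    then have "sum_mat A < k" "card (nonadj (matrix_graph A)) = sum_mat A + 2" using counts by auto
    then show ?thesis by (simp add: optimal_def dims min_sq_less)
  next
    assume hz: "1 \<le> ?h \<and> ?z = 1"
    have "?h + ?z \<le> k"
    proof -
      have "?h + ?z = card ({a. a < k \<and> A $$ (a, a) = 2} \<union> {a. a < k \<and> A $$ (a, a) = 0})"
        by (intro card_Un_disjoint[symmetric]) auto
      also have "\<dots> \<le> card {..<k}" by (intro card_mono) auto
      finally show ?thesis by simp
    qed
    then have "k \<le> sum_mat A" "sum_mat A < 2 * k" using counts(1) hz by auto
    moreover have "int (card (nonadj (matrix_graph A))) = int (sum_mat A) + 2 * (int (sum_mat A) + 1 - int k)"
      using counts hz by simp
    ultimately show ?thesis
      by (simp add: optimal_def dims min_sq_div_1 div_eq_1)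
  qed
qed

lemma tiny_or_small_ambiguous:
  assumes A: "A \<in> carrier_mat k k" and "tiny A \<or> small A"
  shows "ambiguously_colorable k (matrix_graph A)"
proof -
  let ?H = "{a. a < k \<and> A $$ (a, a) = 2}" and ?Z = "{a. a < k \<and> A $$ (a, a) = 0}"
  have d: "diagonal_mat A" and "card ?H = 1 \<and> 2 \<le> card ?Z \<or> 1 \<le> card ?H \<and> card ?Z = 1"
    using assms(2) unfolding tiny_iff[OF A] small_iff[OF A] by blast+
  then have "card ?H \<noteq> 0" "card ?Z \<noteq> 0" by linarith+
  then have "?H \<noteq> {}" "?Z \<noteq> {}" by (metis card.empty)+
  then obtain h z where hz: "h < k" "A $$ (h, h) = 2" "z < k" "A $$ (z, z) = 0" by blast
  let ?v = "(h, h, 1 :: nat)" and ?u = "(h, h, 0 :: nat)"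
  have range: "fst \<in> cells A \<rightarrow> {..<k}" "fst(?v := z) \<in> cells A \<rightarrow> {..<k}"
    using A hz by (auto simp: cells_def)
  have uv: "?u \<in> cells A" "?v \<in> cells A"
    using A hz by (auto simp: cells_def)
  \<comment> \<open>A vertex of row \<open>z\<close> would sit at the zero diagonal entry or off the
    diagonal.\<close>
  have z: "fst v \<noteq> z" if "v \<in> cells A" for v
    using that d hz A by (cases "fst (snd v) = z") (auto simp: cells_def diagonal_mat_def)
  have p: "proper (matrix_graph A) fst"
    using proper_bicolored_graph(1) by (simp add: matrix_graph_eq)
  have "proper (matrix_graph A) (fst(?v := z))"
    unfolding proper_def verts_matrix_graph
  proof (intro ballI impI)
    fix x y assume xy: "x \<in> cells A" "y \<in> cells A" "(fst(?v := z)) x = (fst(?v := z)) y"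
    then have "fst x = fst y"
      using z[OF xy(1)] z[OF xy(2)] by (auto split: if_splits)
    then show "{x, y} \<notin> edges (matrix_graph A)"
      using p xy by (simp add: proper_def verts_matrix_graph)
  qed
  moreover have "fst ?u = fst ?v" "(fst(?v := z)) ?u \<noteq> (fst(?v := z)) ?v"
    using z[OF uv(2)] by auto
  ultimately show ?thesis
    unfolding ambiguously_colorable_iff[OF simple_matrix_graph] verts_matrix_graph
    using range p uv by blast
qed

section \<open>The extremal graphs\<close>

text \<open>If no two non-edges meet, nonadjacency is an equivalence relation, and its classes serve
  as color classes. A class with three vertices would contain two meeting non-edges.\<close>

lemma matching_coloring:
  assumes "simple_graph G"
    and matching: "\<forall>u v w. (u, v) \<in> nonadj G \<and> (v, w) \<in> nonadj G \<and> u \<noteq> v \<and> v \<noteq> w \<longrightarrow> u = w"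
  obtains p :: "'a \<Rightarrow> nat" and l where "p ` verts G = {..<l}"
    "nonadj G = nonadj (bicolored_graph (verts G) p p)" "\<forall>i. card {v \<in> verts G. p v = i} \<le> 2"
proof -
  let ?V = "verts G" and ?R = "nonadj G"
  have refl: "(v, v) \<in> ?R" if "v \<in> ?V" for v
    using that simple_graph_no_loop[OF assms(1)] by (simp add: nonadj_def)
  have sym: "(v, u) \<in> ?R" if "(u, v) \<in> ?R" for u v
    using that by (simp add: nonadj_def insert_commute)
  have trans: "(u, w) \<in> ?R" if "(u, v) \<in> ?R" "(v, w) \<in> ?R" for u v w
  proof (cases "u = v \<or> v = w")
    case False
    then have "u = w" using matching that by blast
    then show ?thesis using refl[of u] that(1) by (simp add: nonadj_def)
  qed (use that in auto)
  have sub: "?R \<subseteq> ?V \<times> ?V" by (auto simp: nonadj_def)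
  have R: "equiv ?V ?R"
    unfolding equiv_def refl_on_def sym_def trans_def using refl sym trans sub by blast
  have "coloring (card (?V // ?R)) G (?V // ?R)"
    unfolding coloring_def
  proof (intro conjI ballI)
    show "partition_on ?V (?V // ?R)" using R by (rule partition_on_quotient)
    fix C assume C: "C \<in> ?V // ?R"
    then have "C \<subseteq> ?V" using sub by (auto simp: quotient_def)
    moreover have "(x, y) \<in> ?R" if "x \<in> C" "y \<in> C" for x y
      using in_quotient_imp_in_rel[OF R C] that by blast
    ultimately show "anticlique G C"
      by (auto simp: anticlique_def indep_def nonadj_def)
  qed simp
  then obtain p where p: "p ` ?V = {..<card (?V // ?R)}" "proper G p"
    "?V // ?R = (\<lambda>u. {v \<in> ?V. p v = p u}) ` ?V"
    using coloring_imp_map[OF assms(1)] by blast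
  have same: "(u, v) \<in> ?R \<longleftrightarrow> u \<in> ?V \<and> v \<in> ?V \<and> p u = p v" for u v
  proof
    assume uv: "(u, v) \<in> ?R"
    then have V: "u \<in> ?V" "v \<in> ?V" using sub by auto
    then have "?R `` {u} \<in> ?V // ?R" by (intro quotientI)
    then obtain z where "?R `` {u} = {v \<in> ?V. p v = p z}" unfolding p(3) by blast
    then have "p u = p z" "p v = p z" using uv refl[OF V(1)] by auto
    with V show "u \<in> ?V \<and> v \<in> ?V \<and> p u = p v" by simp
  next
    assume "u \<in> ?V \<and> v \<in> ?V \<and> p u = p v"
    then show "(u, v) \<in> ?R" using p(2) by (simp add: proper_def nonadj_def)
  qed
  have "card {v \<in> ?V. p v = i} \<le> 2" for i
  proof (rule ccontr)
    assume "\<not> ?thesis"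
    then have "3 \<le> card {v \<in> ?V. p v = i}" by simp
    then obtain T where T: "T \<subseteq> {v \<in> ?V. p v = i}" "card T = 3"
      by (rule obtain_subset_with_card_n)
    then obtain a b c where abc: "T = {a, b, c}" "a \<noteq> b" "a \<noteq> c" "b \<noteq> c"
      by (auto simp: card_3_iff)
    then have "(a, b) \<in> ?R" "(b, c) \<in> ?R" using T(1) by (auto simp: same)
    then show False using matching abc by blast
  qed
  moreover have "?R = nonadj (bicolored_graph ?V p p)"
    using same unfolding nonadj_bicolored_graph by auto
  ultimately show ?thesis using p(1) that by blast
qed

text \<open>Using \<open>p\<close> both for rows and for columns puts all vertices on the
  diagonal.\<close>

lemma diagonal_of_coloring:
  fixes p :: "'a \<Rightarrow> nat"
  assumes "finite (verts G)" and "p \<in> verts G \<rightarrow> {..<k}"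
    and "nonadj G = nonadj (bicolored_graph (verts G) p p)"
  obtains A where "A \<in> carrier_mat k k" "diagonal_mat A"
    "\<forall>a<k. A $$ (a, a) = card {v \<in> verts G. p v = a}" "sum_mat A = card (verts G)"
    "graph_iso G (matrix_graph A)"
proof -
  let ?A = "mat k k (\<lambda>(i, j). card {v \<in> verts G. p v = i \<and> p v = j})"
  have iso: "graph_iso G (matrix_graph ?A)"
    using assms by (intro graph_iso_matrix_graph) auto
  then have "sum_mat ?A = card (verts G)"
    using graph_iso_card_verts by (fastforce simp: verts_matrix_graph card_cells)
  moreover have "card {v \<in> verts G. p v = i \<and> p v = j} = 0" if "i \<noteq> j" for i j
  proof -
    have "{v \<in> verts G. p v = i \<and> p v = j} = {}" using that by blast
    then show ?thesis by (simp only: card.empty)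
  qed
  then have "diagonal_mat ?A"
    by (simp add: diagonal_mat_def)
  ultimately show ?thesis using iso by (intro that[of ?A]) auto
qed

text \<open>The matching leaves l = n - h color classes, at most k in number; the other diagonal
  entries are zeros.\<close>

lemma matching_diagonal:
  assumes "simple_graph G"
    and "\<forall>u v w. (u, v) \<in> nonadj G \<and> (v, w) \<in> nonadj G \<and> u \<noteq> v \<and> v \<noteq> w \<longrightarrow> u = w"
    and "card (nonadj G) = card (verts G) + 2 * h" and "card (verts G) \<le> k + h"
  obtains A where "A \<in> carrier_mat k k" "diagonal_mat A" "\<forall>a<k. A $$ (a, a) \<le> 2"
    "card {a. a < k \<and> A $$ (a, a) = 2} = h"
    "card {a. a < k \<and> A $$ (a, a) = 0} + card (verts G) = k + h"
    "sum_mat A = card (verts G)" "graph_iso G (matrix_graph A)"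
proof -
  have fV: "finite (verts G)" using assms(1) by (simp add: simple_graph_def)
  obtain p :: "'a \<Rightarrow> nat" and l where p: "p ` verts G = {..<l}"
    "nonadj G = nonadj (bicolored_graph (verts G) p p)" "\<forall>i. card {v \<in> verts G. p v = i} \<le> 2"
    by (rule matching_coloring[OF assms(1,2)])
  have range: "p \<in> verts G \<rightarrow> {..<m}" if "l \<le> m" for m
  proof (rule Pi_I)
    fix v assume "v \<in> verts G"
    then have "p v \<in> p ` verts G" by (rule imageI)
    then show "p v \<in> {..<m}" using that unfolding p(1) by simp
  qed
  \<comment> \<open>The matrix of size \<open>l\<close> has no zero on its diagonal, so counting its
    entries determines \<open>l\<close>.\<close>
  obtain B where B: "B \<in> carrier_mat l l" "diagonal_mat B"
    "\<forall>a<l. B $$ (a, a) = card {v \<in> verts G. p v = a}" "sum_mat B = card (verts G)"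
    "graph_iso G (matrix_graph B)"
    by (rule diagonal_of_coloring[OF fV range[OF order_refl] p(2)])
  have "\<exists>v\<in>verts G. p v = a" if "a < l" for a
    using p(1) that by (metis imageE lessThan_iff)
  then have "B $$ (a, a) \<noteq> 0" if "a < l" for a
    using that fV by (auto simp: B(3) card_eq_0_iff)
  then have "{a. a < l \<and> B $$ (a, a) = 0} = {}" by blast
  then have "card {a. a < l \<and> B $$ (a, a) = 0} = 0" by (simp only: card.empty)
  moreover have "\<And>a. a < l \<Longrightarrow> B $$ (a, a) \<le> 2" using B(3) p(3) by simp
  note diagonal_counts[OF B(1,2) this]
  ultimately have "card (verts G) = l + h"
    using assms(3) graph_iso_card_nonadj[OF B(5)] B(4) by linarith
  then have "l \<le> k" using assms(4) by simp
  obtain A where A: "A \<in> carrier_mat k k" "diagonal_mat A"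
    "\<forall>a<k. A $$ (a, a) = card {v \<in> verts G. p v = a}" "sum_mat A = card (verts G)"
    "graph_iso G (matrix_graph A)"
    by (rule diagonal_of_coloring[OF fV range[OF \<open>l \<le> k\<close>] p(2)])
  have two: "\<And>a. a < k \<Longrightarrow> A $$ (a, a) \<le> 2" using A(3) p(3) by simp
  note c = diagonal_counts[OF A(1,2) two]
  have h: "card {a. a < k \<and> A $$ (a, a) = 2} = h"
    using c(2) A(4) assms(3) graph_iso_card_nonadj[OF A(5)] by simp
  then have "card {a. a < k \<and> A $$ (a, a) = 0} + card (verts G) = k + h"
    using c(1) A(4) by simp
  then show ?thesis
    using A two h by (intro that[of A]) auto
qed

lemma card_nonadj_complement:
  assumes "simple_graph G" and "card (nonadj G) = card (verts G) + 2 * h"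
  shows "card (nsets (verts G) 2 - edges G) = h"
proof -
  let ?n = "card (verts G)"
  have "2 * (n choose 2) + n = n\<^sup>2" for n :: nat
    by (induction n) (auto simp: numeral_2_eq_2 power2_eq_square)
  note square = this[of ?n]
  have diff: "card (nsets (verts G) 2 - edges G) = (?n choose 2) - card (edges G)"
    using assms(1) simple_graph_finite_edges[OF assms(1)]
    by (subst card_Diff_subset) (auto simp: simple_graph_def)
  have "card (edges G) \<le> card (nsets (verts G) 2)"
    using assms(1) by (intro card_mono finite_imp_finite_nsets) (auto simp: simple_graph_def)
  then have "card (edges G) \<le> ?n choose 2" by simp
  with square card_nonadj[OF assms(1)] assms(2) show ?thesis
    unfolding diff by linarith
qed

text \<open>
  Deleting one endpoint of each of the \<open>h\<close> non-edges leaves a clique; if two non-edges meet,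
  \<open>h - 1\<close> deletions suffice.
\<close>

lemma nonadj_matching:
  assumes "simple_graph G" and "card (nonadj G) = card (verts G) + 2 * h"
    and "\<not> contains_complete (card (verts G) + 1 - h) G"
    and uv: "(u, v) \<in> nonadj G" and vw: "(v, w) \<in> nonadj G" and "u \<noteq> v" and "v \<noteq> w"
  shows "u = w"
proof (rule ccontr)
  assume "u \<noteq> w"
  let ?V = "verts G"
  have fV: "finite ?V" using assms(1) by (simp add: simple_graph_def)
  define F where "F = nsets ?V 2 - edges G"
  have cF: "card F = h"
    unfolding F_def using assms(1,2) by (rule card_nonadj_complement)
  have fF: "finite F" using fV by (simp add: F_def finite_imp_finite_nsets)
  have F: "{x, y} \<in> F \<longleftrightarrow> (x, y) \<in> nonadj G" if "x \<noteq> y" for x y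
    using that by (auto simp: F_def nsets_def nonadj_def)
  \<comment> \<open>The endpoint \<open>v\<close> is preferred, so that \<open>{u, v}\<close> and
    \<open>{v, w}\<close> share their deleted vertex.\<close>
  define c where "c e = (if v \<in> e then v else SOME x. x \<in> e)" for e
  have c: "c e \<in> e" if "e \<in> F" for e
  proof -
    have "e \<noteq> {}" using that by (auto simp: F_def nsets_def)
    then show ?thesis by (auto simp: c_def some_in_eq)
  qed
  have e: "{u, v} \<in> F" "{v, w} \<in> F" "{u, v} \<noteq> {v, w}"
    using F uv vw assms(6,7) \<open>u \<noteq> w\<close> by (auto simp: doubleton_eq_iff)
  have "c ` F = c ` (F - {{u, v}})"
  proof -
    have "c {u, v} \<in> c ` (F - {{u, v}})"
      using e by (intro image_eqI[of _ _ "{v, w}"]) (auto simp: c_def)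
    then show ?thesis by auto
  qed
  then have "card (c ` F) \<le> card (F - {{u, v}})"
    using fF by (metis card_image_le finite_Diff)
  then have X: "card (c ` F) \<le> h - 1"
    using e(1) cF by (simp add: card_Diff_singleton)
  have "h \<ge> 1"
    using e(1) fF cF by (metis One_nat_def Suc_leI card_gt_0_iff empty_iff)
  have "card ?V - card (c ` F) \<le> card (?V - c ` F)"
    using fF by (intro diff_card_le_card_Diff) auto
  then have "card ?V + 1 - h \<le> card (?V - c ` F)" using X \<open>h \<ge> 1\<close> by linarith
  then obtain T where T: "T \<subseteq> ?V - c ` F" "card T = card ?V + 1 - h"
    by (rule obtain_subset_with_card_n)
  have "clique T (edges G)"
    unfolding clique_def
  proof (intro ballI impI)
    fix x y assume xy: "x \<in> T" "y \<in> T" "x \<noteq> y"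
    show "{x, y} \<in> edges G"
    proof (rule ccontr)
      assume "{x, y} \<notin> edges G"
      then have "{x, y} \<in> F" using xy T(1) by (auto simp: F nonadj_def)
      then have "c {x, y} \<in> c ` F" "c {x, y} = x \<or> c {x, y} = y" using c[of "{x, y}"] by auto
      then have "x \<in> c ` F \<or> y \<in> c ` F" by metis
      then show False using xy(1,2) T(1) by blast
    qed
  qed
  then have "contains_complete (card ?V + 1 - h) G"
    using T unfolding contains_complete_def by blast
  with assms(3) show False by contradiction
qed

section \<open>Graphs on fewer than k vertices and graphs without a clique of order k\<close>

text \<open>Ambiguity requires a nonadjacent pair of distinct vertices beyond the diagonal. With
  equality it is the only non-edge, a matching with \<open>h = 1\<close>, and n < k leaves at least
  two zeros.\<close>

lemma ambiguous_few_vertices: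
  assumes G: "simple_graph G" and "ambiguously_colorable k G" and n: "card (verts G) < k"
  shows "card (verts G) + 2 \<le> card (nonadj G)"
    and "card (nonadj G) = card (verts G) + 2 \<Longrightarrow>
      \<exists>A\<in>carrier_mat k k. tiny A \<and> sum_mat A = card (verts G) \<and> graph_iso G (matrix_graph A)"
proof -
  let ?V = "verts G"
  have fV: "finite ?V" using G by (simp add: simple_graph_def)
  obtain a b where ab: "(a, b) \<in> nonadj G" "a \<noteq> b"
    using ambiguous_nonadj[OF assms(1,2)] by blast
  let ?S = "(\<lambda>v. (v, v)) ` ?V \<union> {(a, b), (b, a)}"
  have sub: "?S \<subseteq> nonadj G"
    using ab simple_graph_no_loop[OF G] by (auto simp: nonadj_def insert_commute)
  have "card ?S = card ((\<lambda>v. (v, v)) ` ?V) + card {(a, b), (b, a)}"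
    using fV ab(2) by (intro card_Un_disjoint) auto
  then have S: "card ?S = card ?V + 2"
    using ab(2) by (simp add: card_image inj_on_def)
  show le: "card ?V + 2 \<le> card (nonadj G)"
    using card_mono[OF finite_nonadj[OF fV] sub] S by simp
  assume eq: "card (nonadj G) = card ?V + 2"
  have "?S = nonadj G"
    using card_subset_eq[OF finite_nonadj[OF fV] sub] S eq by simp
  then have matching: "\<forall>u v w. (u, v) \<in> nonadj G \<and> (v, w) \<in> nonadj G \<and> u \<noteq> v \<and> v \<noteq> w \<longrightarrow> u = w"
    by (auto simp flip: \<open>?S = nonadj G\<close>)
  have two: "card (nonadj G) = card ?V + 2 * 1" using eq by simp
  have "card ?V \<le> k + 1" using n by simp
  with G matching two obtain A where A: "A \<in> carrier_mat k k" "diagonal_mat A" "\<forall>a<k. A $$ (a, a) \<le> 2"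
    "card {a. a < k \<and> A $$ (a, a) = 2} = 1"
    "card {a. a < k \<and> A $$ (a, a) = 0} + card (verts G) = k + 1"
    "sum_mat A = card (verts G)" "graph_iso G (matrix_graph A)"
    by (rule matching_diagonal)
  then have "tiny A" unfolding tiny_iff[OF A(1)] using n by auto
  with A show "\<exists>A\<in>carrier_mat k k. tiny A \<and> sum_mat A = card ?V \<and> graph_iso G (matrix_graph A)"
    by blast
qed

text \<open>Turan's sizes for k - 1 classes are completed by an empty class, whose gap m (m + 1)
  already reaches 2 m. Equality gives m = 1, and the n - k + 1 non-edges form a matching because a
  clique of order k is absent.\<close>

lemma no_clique:
  assumes G: "simple_graph G" and "\<not> contains_complete k G" and k: "0 < k" "k \<le> card (verts G)"
  defines "n \<equiv> card (verts G)"
  shows "min_sq n k + 2 * int (n div k) \<le> int (card (nonadj G))"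
    and "int (card (nonadj G)) = min_sq n k + 2 * int (n div k) \<Longrightarrow>
      \<exists>A\<in>carrier_mat k k. small A \<and> sum_mat A = n \<and> graph_iso G (matrix_graph A)"
proof -
  define m where "m = n div k"
  have m1: "1 \<le> m" using k div_greater_zero_iff[of n k] by (simp add: m_def n_def Suc_le_eq)
  obtain k' where k': "k = Suc k'" using k(1) by (cases k) auto
  obtain a where a: "(\<Sum>i<k'. a i) = n" "(\<Sum>i<k'. (a i)\<^sup>2) \<le> card (nonadj G)"
    using turan_class_sizes[of G k'] assms(1,2) unfolding k' n_def by blast
  \<comment> \<open>The class of size 0 makes the sum comparable with
    \<open>min_sq n k\<close>.\<close>
  let ?a = "a(k' := 0)"
  have a0: "(\<Sum>i<k. f (?a i)) = (\<Sum>i<k'. f (a i))" if "f 0 = 0" for f :: "nat \<Rightarrow> nat"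
    unfolding k' using that by (auto intro!: sum.cong)
  have "(\<Sum>i<k. int (?a i) ^ 2) = min_sq n k + (\<Sum>i<k. gap m (?a i))"
    unfolding m_def using a0[of "\<lambda>x. x"] a(1) by (intro sum_squares_eq) auto
  moreover have "(\<Sum>i<k. int (?a i) ^ 2) = int (\<Sum>i<k. (?a i) ^ 2)" by simp
  moreover have "(\<Sum>i<k. (?a i) ^ 2) \<le> card (nonadj G)"
    using a0[of "\<lambda>x. x\<^sup>2"] a(2) by simp
  moreover have "gap m (?a k') \<le> (\<Sum>i<k. gap m (?a i))"
    using gap_nonneg unfolding k' by (intro member_le_sum) auto
  then have "int m * (int m + 1) \<le> (\<Sum>i<k. gap m (?a i))"
    by (simp add: gap_def algebra_simps)
  ultimately have le: "min_sq n k + int m * (int m + 1) \<le> int (card (nonadj G))"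
    by linarith
  moreover have "2 * int m \<le> int m * (int m + 1)"
    using mult_pred_nonneg[of "int m"] by (simp add: algebra_simps)
  ultimately show "min_sq n k + 2 * int (n div k) \<le> int (card (nonadj G))"
    unfolding m_def[symmetric] by linarith
  assume eq: "int (card (nonadj G)) = min_sq n k + 2 * int (n div k)"
  have "m = 1"
  proof (rule ccontr)
    assume "m \<noteq> 1"
    then have "2 * int m < (int m + 1) * int m"
      using m1 by (intro mult_strict_right_mono) auto
    then show False using le eq unfolding m_def[symmetric] by (simp add: mult.commute)
  qed
  then have n2: "n < 2 * k"
    using dividend_less_times_div[of k n] k(1) by (simp add: m_def)
  have kn: "k \<le> n" using k(2) by (simp add: n_def)
  \<comment> \<open>Chosen so that k + 3 (n - k) + 2 = n + 2 h and n + 1 - h = k.\<close>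
  define h where "h = n - k + 1"
  have "int (card (nonadj G)) = int k + 3 * (int n - int k) + 2"
    using eq \<open>m = 1\<close> min_sq_div_1[OF kn n2] by (simp add: m_def)
  moreover have "int h = int n - int k + 1" using kn by (simp add: h_def of_nat_diff)
  ultimately have "int (card (nonadj G)) = int (card (verts G) + 2 * h)"
    unfolding n_def[symmetric] by simp
  then have N: "card (nonadj G) = card (verts G) + 2 * h"
    unfolding of_nat_eq_iff .
  have "card (verts G) + 1 - h = k" using kn unfolding h_def n_def[symmetric] by simp
  then have matching: "\<forall>u v w. (u, v) \<in> nonadj G \<and> (v, w) \<in> nonadj G \<and> u \<noteq> v \<and> v \<noteq> w \<longrightarrow> u = w"
    using nonadj_matching[OF G N] assms(2) by metis
  have "card (verts G) \<le> k + h" using kn unfolding h_def n_def[symmetric] by simp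
  with G matching N obtain A where A: "A \<in> carrier_mat k k" "diagonal_mat A" "\<forall>a<k. A $$ (a, a) \<le> 2"
    "card {a. a < k \<and> A $$ (a, a) = 2} = h"
    "card {a. a < k \<and> A $$ (a, a) = 0} + card (verts G) = k + h"
    "sum_mat A = card (verts G)" "graph_iso G (matrix_graph A)"
    by (rule matching_diagonal)
  then have "small A" unfolding small_iff[OF A(1)] using kn by (auto simp: h_def n_def)
  with A show "\<exists>A\<in>carrier_mat k k. small A \<and> sum_mat A = n \<and> graph_iso G (matrix_graph A)"
    unfolding n_def by blast
qed

section \<open>Graphs with a clique of order k\<close>

lemma proper_comp:
  assumes "proper G p" and "p \<in> verts G \<rightarrow> S" and "inj_on f S"
  shows "proper G (f \<circ> p)"
  unfolding proper_def
proof (intro ballI impI)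
  fix u v assume uv: "u \<in> verts G" "v \<in> verts G" "(f \<circ> p) u = (f \<circ> p) v"
  then have "p u = p v"
    using inj_onD[OF assms(3), of "p u" "p v"] assms(2) by auto
  then show "{u, v} \<notin> edges G" using assms(1) uv by (simp add: proper_def)
qed

lemma proper_bij_clique:
  assumes "proper G p" and "p \<in> verts G \<rightarrow> {..<k}" and "K \<subseteq> verts G" and "card K = k" and "clique K (edges G)"
  shows "bij_betw p K {..<k}"
proof -
  have inj: "inj_on p K"
  proof (rule inj_onI)
    fix x y assume "x \<in> K" "y \<in> K" "p x = p y"
    then show "x = y"
      using assms(1,3,5) unfolding proper_def clique_def by blast
  qed
  moreover have "p ` K = {..<k}"
    using assms(2,3,4) card_image[OF inj] by (intro card_subset_eq) auto
  ultimately show ?thesis by (simp add: bij_betw_def)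
qed

text \<open>A clique of order \<open>k\<close> meets every class of both colorings exactly once;
  renaming the colors of \<open>q\<close> along it makes the colorings agree on it. A renaming of
  both then gives a recolored vertex the colors 0 and 1, which places the off-diagonal entries of
  extremal matrices in the first two rows and columns.\<close>

lemma ambiguous_common_representatives:
  assumes G: "simple_graph G" and "ambiguously_colorable k G" and "contains_complete k G"
  shows "\<exists>p q w. common_representatives G k p q \<and> w \<in> verts G \<and> p w = 0 \<and> q w = 1"
proof -
  let ?V = "verts G"
  obtain p q u v where pq: "p \<in> ?V \<rightarrow> {..<k}" "q \<in> ?V \<rightarrow> {..<k}" "proper G p" "proper G q"
    and uv: "u \<in> ?V" "v \<in> ?V" "p u = p v" "q u \<noteq> q v"
    using assms(2) unfolding ambiguously_colorable_iff[OF G] by blast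
  obtain K where K: "K \<subseteq> ?V" "card K = k" "clique K (edges G)"
    using assms(3) by (auto simp: contains_complete_def)
  note bp = proper_bij_clique[OF pq(3,1) K] and bq = proper_bij_clique[OF pq(4,2) K]
  \<comment> \<open>Translates the \<open>q\<close>-color of a clique vertex into its
    \<open>p\<close>-color.\<close>
  define f where "f = p \<circ> inv_into K q"
  have bf: "bij_betw f {..<k} {..<k}"
    unfolding f_def using bij_betw_inv_into[OF bq] bp by (rule bij_betw_trans)
  have fq: "f (q v) = p v" if "v \<in> K" for v
    using bij_betw_inv_into_left[OF bq that] by (simp add: f_def)
  have q_range: "f \<circ> q \<in> ?V \<rightarrow> {..<k}"
    using pq(2) bij_betwE[OF bf] by auto
  have q_proper: "proper G (f \<circ> q)"
    using pq(4,2) bij_betw_imp_inj_on[OF bf] by (rule proper_comp)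
  have "f (q u) \<noteq> f (q v)"
    using inj_onD[OF bij_betw_imp_inj_on[OF bf], of "q u" "q v"] uv pq(2) by auto
  \<comment> \<open>Since \<open>u\<close> and \<open>v\<close> agree under \<open>p\<close> but not
    under the translated \<open>q\<close>, one of them is recolored.\<close>
  then obtain w where w: "w \<in> ?V" "p w \<noteq> f (q w)" using uv by metis
  have lt: "p w < k" "f (q w) < k" using w(1) pq(1) q_range by auto
  \<comment> \<open>The inner transposition sends \<open>p w\<close> to 0 and \<open>f (q w)\<close>
    to a nonzero color, which the outer one exchanges with 1 while fixing 0.\<close>
  define s where "s = Transposition.transpose 1 (Transposition.transpose 0 (p w) (f (q w))) \<circ> Transposition.transpose 0 (p w)"
  have ne: "Transposition.transpose 0 (p w) (f (q w)) \<noteq> 0"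
    using w(2) by (auto simp: Transposition.transpose_def)
  then have s01: "s (p w) = 0" "s (f (q w)) = 1"
    unfolding s_def by (auto simp: Transposition.transpose_def[of 1])
  have "1 < k" using lt w(2) by linarith
  have tl: "bij_betw (Transposition.transpose a b) {..<k} {..<k}" if "a < k" "b < k" for a b
    using that by simp
  have "Transposition.transpose 0 (p w) (f (q w)) < k"
    using lt \<open>1 < k\<close> by (auto simp: Transposition.transpose_def)
  then have bs: "bij_betw s {..<k} {..<k}"
    unfolding s_def using lt \<open>1 < k\<close> by (intro bij_betw_trans[OF tl tl]) auto
  have s_range: "s \<circ> g \<in> ?V \<rightarrow> {..<k}" if "g \<in> ?V \<rightarrow> {..<k}" for g
    using that bij_betwE[OF bs] by auto
  have "common_representatives G k (s \<circ> p) (s \<circ> (f \<circ> q))"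
  proof
    show "s \<circ> p \<in> ?V \<rightarrow> {..<k}" "s \<circ> (f \<circ> q) \<in> ?V \<rightarrow> {..<k}"
      using s_range[OF pq(1)] s_range[OF q_range] by auto
    show "proper G (s \<circ> p)" "proper G (s \<circ> (f \<circ> q))"
      using proper_comp[OF pq(3,1) bij_betw_imp_inj_on[OF bs]]
        proper_comp[OF q_proper q_range bij_betw_imp_inj_on[OF bs]] by auto
    fix i assume "i < k"
    then have "i \<in> (s \<circ> p) ` K"
      using bij_betw_trans[OF bp bs] by (simp add: bij_betw_def)
    then obtain v where "v \<in> K" "(s \<circ> p) v = i" by blast
    then show "\<exists>v\<in>?V. (s \<circ> p) v = i \<and> (s \<circ> (f \<circ> q)) v = i"
      using K(1) fq by auto
  qed (rule G)
  then show ?thesis using w(1) s01 by (intro exI[of _ "s \<circ> p"] exI[of _ "s \<circ> (f \<circ> q)"]) auto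
qed

text \<open>A single recolored vertex is the off-diagonal one of a special matrix. Two recolored
  vertices exchange the colors 0 and 1, whose diagonal cells are singletons; this is the block of
  ones.\<close>

lemma (in common_representatives) optimal_block:
  assumes w: "w \<in> verts G" "p w = 0" "q w = 1"
  defines "n \<equiv> card (verts G)"
  assumes eq: "int (card (nonadj G)) = min_sq n k + 2 * int (n div k)"
  shows "\<exists>A\<in>carrier_mat k k. (special_at A 0 1 \<or> twin_block A) \<and> graph_iso G (matrix_graph A)"
proof -
  let ?V = "verts G"
  let ?cell = "\<lambda>i j. {v \<in> ?V. p v = i \<and> q v = j}"
  let ?A = "mat k k (\<lambda>(i, j). card (?cell i j))"
  have wU: "w \<in> U" using w by (simp add: U_def)
  have k: "1 < k" using funcset_mem[OF q_range w(1)] w(3) by simp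
  have iso: "graph_iso G (matrix_graph ?A)"
    using finite_verts nonadj_eq[OF wU eq[unfolded n_def]] p_range q_range by (rule graph_iso_matrix_graph)
  have diag: "?A $$ (i, i) = card (D i)" "?A $$ (i, i) \<noteq> 0" if "i < k" for i
    using that card_D_pos[OF that] by (auto simp: D_def)
  have cell: "?cell i j = {v \<in> U. p v = i \<and> q v = j}" if "i \<noteq> j" for i j
    using that by (auto simp: U_def)
  from few_recolored[OF wU eq[unfolded n_def]] consider "U = {w}"
    | u where "u \<noteq> w" "U = {u, w}" "p u = q w" "p w = q u" "card (D (q u)) = 1" "card (D (q w)) = 1"
    by blast
  then have "special_at ?A 0 1 \<or> twin_block ?A"
  proof cases
    case 1
    have "?cell 0 1 = {w}" using cell[of 0 1] 1 w by auto
    then have one: "card (?cell 0 1) = 1" by (simp only: card.insert finite.emptyI) auto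
    have zero: "card (?cell i j) = 0" if "i \<noteq> j" "(i, j) \<noteq> (0, 1)" for i j
    proof -
      have "?cell i j = {}" using cell[OF that(1)] that 1 w by auto
      then show ?thesis by (simp only: card.empty)
    qed
    have "special_at ?A 0 1"
      unfolding special_at_def
    proof (intro conjI allI impI)
      fix l assume "l < dim_row ?A"
      then show "?A $$ (l, l) \<noteq> 0" using diag(2)[of l] by simp
    next
      fix a b assume "a < dim_row ?A" "b < dim_col ?A" "a \<noteq> b \<and> (a, b) \<noteq> (0, 1)"
      then show "?A $$ (a, b) = 0" using zero[of a b] by simp
    qed (use k one in simp_all)
    then show ?thesis ..
  next
    case 2
    have pu: "p u = 1" "q u = 0" using 2 w by auto
    have "?cell 0 1 = {w}" "?cell 1 0 = {u}" using cell[of 0 1] cell[of 1 0] 2 w pu by auto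
    then have c: "card (?cell 0 1) = 1" "card (?cell 1 0) = 1"
      by (simp_all only: card.insert finite.emptyI) auto
    have d: "?A $$ (0, 0) = 1" "?A $$ (1, 1) = 1"
      using diag(1)[of 0] diag(1)[of 1] 2 w pu k by auto
    have off: "card (?cell i j) = 0" if "i \<noteq> j" "\<not> (i < 2 \<and> j < 2)" for i j
    proof -
      have "?cell i j = {}" using cell[OF that(1)] that 2 w pu by auto
      then show ?thesis by (simp only: card.empty)
    qed
    have "twin_block ?A"
      unfolding twin_block_def
    proof (intro conjI allI impI)
      fix a b :: nat assume "a < 2" "b < 2"
      then show "?A $$ (a, b) = 1"
        using c d k by (auto simp: less_2_cases_iff)
    next
      fix a b assume "a < dim_row ?A" "b < dim_row ?A" "a \<noteq> b \<and> \<not> (a < 2 \<and> b < 2)"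
      then show "?A $$ (a, b) = 0" using off[of a b] by simp
    next
      fix a assume "a < dim_row ?A"
      then show "?A $$ (a, a) \<noteq> 0" using diag(2)[of a] by simp
    qed (use k in simp)
    then show ?thesis ..
  qed
  then show ?thesis using iso by (intro bexI[of _ ?A]) auto
qed

section \<open>The bound, the case of equality and its attainment\<close>

text \<open>For n < k the maximum is 1 and comes from a single non-edge; otherwise it is
  \<open>n div k\<close>, and the presence of a clique of order \<open>k\<close> decides which
  argument applies.\<close>

lemma ambiguous_lower_bound:
  assumes G: "simple_graph G" and "ambiguously_colorable k G" and "0 < k"
  defines "n \<equiv> card (verts G)"
  shows "min_sq n k + 2 * int (max 1 (n div k)) \<le> int (card (nonadj G))"
    and "int (card (nonadj G)) = min_sq n k + 2 * int (max 1 (n div k)) \<Longrightarrow>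
      \<exists>A\<in>carrier_mat k k. (tiny A \<or> small A \<or> special_at A 0 1 \<or> twin_block A) \<and> graph_iso G (matrix_graph A)"
proof -
  consider "n < k" | "k \<le> n" "\<not> contains_complete k G" | "k \<le> n" "contains_complete k G"
    by linarith
  then have "min_sq n k + 2 * int (max 1 (n div k)) \<le> int (card (nonadj G)) \<and>
    (int (card (nonadj G)) = min_sq n k + 2 * int (max 1 (n div k)) \<longrightarrow>
      (\<exists>A\<in>carrier_mat k k. (tiny A \<or> small A \<or> special_at A 0 1 \<or> twin_block A) \<and> graph_iso G (matrix_graph A)))"
    (is "?P \<and> (?E \<longrightarrow> ?A)")
  proof cases
    case 1
    note few = ambiguous_few_vertices[OF assms(1,2), folded n_def, OF 1]
    have "min_sq n k + 2 * int (max 1 (n div k)) = int (n + 2)"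
      using 1 by (simp add: min_sq_less)
    then show ?thesis using few by (auto simp del: of_nat_add)
  next
    case 2
    then have "max 1 (n div k) = n div k"
      using assms(3) div_greater_zero_iff[of n k] by (simp add: max_def)
    then show ?thesis
      using no_clique[OF G 2(2) assms(3) 2(1)[unfolded n_def], folded n_def] by auto
  next
    case 3
    then have m: "max 1 (n div k) = n div k"
      using assms(3) div_greater_zero_iff[of n k] by (simp add: max_def)
    obtain p q w where c: "common_representatives G k p q" and w: "w \<in> verts G" "p w = 0" "q w = 1"
      using ambiguous_common_representatives[OF assms(1,2) 3(2)] by blast
    interpret common_representatives G k p q by (rule c)
    have "w \<in> U" using w by (simp add: U_def)
    from nonadj_lower_bound(1)[OF this] optimal_block[OF w] show ?thesis
      unfolding m unfolding n_def by blast
  qed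
  then show ?P "?E \<Longrightarrow> ?A" by blast+
qed

text \<open>From left to right a special matrix arises only with its off-diagonal one at
  \<open>(0, 1)\<close>; the converse admits every position.\<close>

lemma ambiguous_optimal_iff:
  assumes G: "simple_graph G" and "k \<ge> 2"
  shows "ambiguously_colorable k G \<and>
      int (card (nonadj G)) = min_sq (card (verts G)) k + 2 * int (max 1 (card (verts G) div k)) \<longleftrightarrow>
    (\<exists>A\<in>carrier_mat k k. desirable A \<and> (tiny A \<or> small A \<or> very_special A \<or> mininormal A) \<and>
      sum_mat A = card (verts G) \<and> graph_iso G (matrix_graph A))" (is "?L \<longleftrightarrow> ?R")
proof
  assume ?L
  then have L: "ambiguously_colorable k G"
    "int (card (nonadj G)) = min_sq (card (verts G)) k + 2 * int (max 1 (card (verts G) div k))"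
    by auto
  have "0 < k" using assms(2) by simp
  from ambiguous_lower_bound(2)[OF G L(1) this L(2)] obtain A where A: "A \<in> carrier_mat k k"
    "tiny A \<or> small A \<or> special_at A 0 1 \<or> twin_block A" and iso: "graph_iso G (matrix_graph A)"
    by blast
  have dims: "dim_row A = k" using A by auto
  have n: "sum_mat A = card (verts G)"
    using graph_iso_card_verts[OF iso] by (simp add: verts_matrix_graph card_cells)
  have "optimal A"
    using L(2) graph_iso_card_nonadj[OF iso] by (simp add: optimal_def n dims)
  have "desirable A \<and> (tiny A \<or> small A \<or> very_special A \<or> mininormal A)"
  proof -
    have "special A \<and> very_special A" if "special_at A 0 1"
      using special_at_very_special[OF A(1) that \<open>optimal A\<close>] that by (auto simp: special_def)
    moreover have "normal A \<and> mininormal A" if "twin_block A"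
      using that \<open>optimal A\<close> mininormal_iff[OF A(1)] by (auto simp: normal_def mininormal_def)
    ultimately show ?thesis using A(2) unfolding desirable_def by blast
  qed
  then show ?R using A(1) n iso by blast
next
  assume ?R
  then obtain A where A: "A \<in> carrier_mat k k" "tiny A \<or> small A \<or> very_special A \<or> mininormal A"
    and n: "sum_mat A = card (verts G)" and iso: "graph_iso G (matrix_graph A)" by blast
  have dims: "dim_row A = k" "dim_col A = k" using A by auto
  have opt: "optimal A"
    using A(2) tiny_or_small_optimal[OF A(1)] very_special_optimal[OF A(1)] mininormal_iff[OF A(1)] by blast
  have "ambiguously_colorable k (matrix_graph A)"
  proof -
    consider "tiny A \<or> small A" | "very_special A" | "twin_block A"
      using A(2) mininormal_iff[OF A(1)] by blast
    then show ?thesis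
    proof cases
      case 1
      then show ?thesis by (rule tiny_or_small_ambiguous[OF A(1)])
    next
      case 2
      then obtain i j where "special_at A i j"
        by (auto simp: very_special_def a_special_def b_special_def c_special_def Let_def)
      then show ?thesis
        by (intro ambiguously_colorable_matrix_graph[OF A(1), of i j]) (auto simp: special_at_def dims)
    next
      case 3
      then show ?thesis
        using assms(2) by (intro ambiguously_colorable_matrix_graph[OF A(1), of 0 1]) (auto simp: twin_block_def dims)
    qed
  qed
  then have "ambiguously_colorable k G"
    using graph_iso_ambiguously_colorable[OF iso G simple_matrix_graph] by blast
  then show ?L
    using opt graph_iso_card_nonadj[OF iso] by (simp add: optimal_def n dims)
qed

text \<open>In the balanced graph of residues, the edges from one vertex \<open>x\<close> to a class
  \<open>j\<close> of smallest positive size are deleted, so that \<open>x\<close> may also receive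
  color \<open>j\<close>.\<close>

lemma ambiguous_optimal_exists:
  assumes "n \<ge> 2" and "k \<ge> 2"
  shows "\<exists>G :: nat graph. simple_graph G \<and> card (verts G) = n \<and> ambiguously_colorable k G \<and>
    int (card (nonadj G)) = min_sq n k + 2 * int (max 1 (n div k))"
proof -
  let ?V = "{..<n}"
  let ?p = "\<lambda>u. u mod k"
  let ?c = "\<lambda>i. card {v \<in> ?V. ?p v = i}"
  \<comment> \<open>For n < k the class 0 is a singleton. Otherwise the last residue
    \<open>k - 1\<close> is at least \<open>n mod k\<close>, so its class has size
    \<open>n div k\<close>.\<close>
  have "\<exists>x j. x < n \<and> j < k \<and> ?p x \<noteq> j \<and> ?c j = max 1 (n div k)"
  proof (cases "n < k")
    case True
    then have "?c 0 = 1" using assms card_residue_class[of 0 k n] by simp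
    then show ?thesis using True assms by (intro exI[of _ 1] exI[of _ 0]) auto
  next
    case False
    have "\<not> k - 1 < n mod k" using assms mod_less_divisor[of k n] by linarith
    then have "?c (k - 1) = n div k" using assms card_residue_class[of "k - 1" k n] by simp
    moreover have "n div k \<ge> 1" using False assms div_greater_zero_iff[of n k] by linarith
    ultimately show ?thesis using assms by (intro exI[of _ 0] exI[of _ "k - 1"]) auto
  qed
  then obtain x j where x: "x < n" "j < k" "?p x \<noteq> j" "?c j = max 1 (n div k)" by blast
  define q where "q = ?p(x := j)"
  define G where "G = bicolored_graph ?V ?p q"
  have G: "simple_graph G" "verts G = ?V" by (simp_all add: G_def simple_bicolored_graph)
  have "{v \<in> ?V. ?p v = j} \<noteq> {}" using x(4) by (metis card.empty max_def not_one_le_zero order_refl)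
  then obtain y where y: "y < n" "?p y = j" by auto
  then have "q x = q y" using x(3) by (auto simp: q_def)
  moreover have "?p \<in> ?V \<rightarrow> {..<k}" "q \<in> ?V \<rightarrow> {..<k}"
    using assms x(2) by (auto simp: q_def)
  \<comment> \<open>The map \<open>q\<close> joins \<open>x\<close> and \<open>y\<close> while their
    residues differ, so \<open>q\<close> is taken as the first coloring.\<close>
  ultimately have amb: "ambiguously_colorable k G"
    unfolding ambiguously_colorable_iff[OF G(1)] G(2)
    using x y proper_bicolored_graph[of ?V ?p q] unfolding G_def[symmetric]
    by (intro exI[of _ q] exI[of _ ?p]) auto
  let ?S = "{(u, v). u \<in> ?V \<and> v \<in> ?V \<and> ?p u = ?p v}" and ?J = "{v \<in> ?V. ?p v = j}"
  have "nonadj G \<subseteq> ?S \<union> (Pair x ` ?J \<union> (\<lambda>v. (v, x)) ` ?J)"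
    unfolding G_def nonadj_bicolored_graph by (auto simp: q_def split: if_splits)
  then have "card (nonadj G) \<le> card (?S \<union> (Pair x ` ?J \<union> (\<lambda>v. (v, x)) ` ?J))"
    by (intro card_mono finite_UnI finite_imageI finite_subset[of ?S "?V \<times> ?V"]) auto
  also have "\<dots> \<le> card ?S + (card (Pair x ` ?J) + card ((\<lambda>v. (v, x)) ` ?J))"
    using card_Un_le[of ?S "Pair x ` ?J \<union> (\<lambda>v. (v, x)) ` ?J"]
      card_Un_le[of "Pair x ` ?J" "(\<lambda>v. (v, x)) ` ?J"] by linarith
  also have "\<dots> \<le> card ?S + 2 * ?c j"
    using card_image_le[of ?J "Pair x"] card_image_le[of ?J "\<lambda>v. (v, x)"] by simp
  also have "card ?S = (\<Sum>i<k. (?c i)\<^sup>2)"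
    using assms by (intro card_same_color) auto
  finally have "int (card (nonadj G)) \<le> (\<Sum>i<k. int (?c i) ^ 2) + 2 * int (?c j)"
    by (simp flip: of_nat_power of_nat_sum of_nat_mult of_nat_add)
  also have "(\<Sum>i<k. int (?c i) ^ 2) = min_sq n k"
    using assms by (intro sum_squares_residue_classes) simp
  \<comment> \<open>The count gives an upper bound, which the general lower bound turns into an
    equality.\<close>
  finally have "int (card (nonadj G)) = min_sq n k + 2 * int (max 1 (n div k))"
    using ambiguous_lower_bound(1)[OF G(1) amb] assms x(4) by (simp add: G(2))
  then show ?thesis using G amb by (intro exI[of _ G]) simp
qed

text \<open>The number of nonadjacent pairs and twice the number of edges add up to n^2, so a
  deficit of m edges is an excess of 2 m pairs.\<close>

lemma card_edges_eq_iff: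
  assumes "simple_graph G" and "card (verts G) = n" and "k > 0"
  shows "int (card (edges G)) = int (ex_complete n (k + 1)) - m \<longleftrightarrow> int (card (nonadj G)) = min_sq n k + 2 * m"
    and "int (card (edges G)) \<le> int (ex_complete n (k + 1)) - m \<longleftrightarrow> min_sq n k + 2 * m \<le> int (card (nonadj G))"
proof -
  have "int (card (nonadj G)) + 2 * int (card (edges G)) = int n ^ 2"
    using card_nonadj[OF assms(1)] assms(2) by (simp flip: of_nat_power of_nat_mult of_nat_add)
  then show "int (card (edges G)) = int (ex_complete n (k + 1)) - m \<longleftrightarrow> int (card (nonadj G)) = min_sq n k + 2 * m"
    "int (card (edges G)) \<le> int (ex_complete n (k + 1)) - m \<longleftrightarrow> min_sq n k + 2 * m \<le> int (card (nonadj G))"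
    using ex_complete_eq[OF assms(3), of n] by linarith+
qed

theorem theorem2:
  fixes n k :: nat
  assumes "n \<ge> 2" and "k \<ge> 2"
  shows "int (max_edges_ambiguous n k) = int (ex_complete n (k + 1)) - int (max 1 (n div k)) \<and>
    (\<forall>G :: 'v graph. simple_graph G \<and> card (verts G) = n \<longrightarrow>
       (ambiguously_colorable k G \<and>
          int (card (edges G)) = int (ex_complete n (k + 1)) - int (max 1 (n div k))
        \<longleftrightarrow>
        (\<exists>A \<in> carrier_mat k k. desirable A \<and>
           (tiny A \<or> small A \<or> very_special A \<or> mininormal A) \<and>
           sum_mat A = n \<and> graph_iso G (matrix_graph A))))"
proof (intro conjI allI impI)
  have k: "0 < k" using assms(2) by simp
  let ?S = "{card (edges G) | G :: nat graph.
     simple_graph G \<and> card (verts G) = n \<and> ambiguously_colorable k G}"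
  \<comment> \<open>One graph that attains the bound turns it into the value of the maximum.\<close>
  obtain H :: "nat graph" where H: "simple_graph H" "card (verts H) = n" "ambiguously_colorable k H"
    and "int (card (nonadj H)) = min_sq n k + 2 * int (max 1 (n div k))"
    using ambiguous_optimal_exists[OF assms] by blast
  then have e: "int (card (edges H)) = int (ex_complete n (k + 1)) - int (max 1 (n div k))"
    using card_edges_eq_iff(1)[OF H(1,2) k] by simp
  have "c \<le> card (edges H)" if c: "c \<in> ?S" for c
  proof -
    obtain G :: "nat graph" where G: "c = card (edges G)" "simple_graph G" "card (verts G) = n"
      "ambiguously_colorable k G" using c by blast
    have "int (card (edges G)) \<le> int (ex_complete n (k + 1)) - int (max 1 (n div k))"
      using ambiguous_lower_bound(1)[OF G(2,4) k] card_edges_eq_iff(2)[OF G(2,3) k] G(3) by simp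
    then show ?thesis using e G(1) by simp
  qed
  moreover have "card (edges H) \<in> ?S" using H by blast
  ultimately have "max_edges_ambiguous n k = card (edges H)"
    unfolding max_edges_ambiguous_def using finite_edge_counts by (intro Max_eqI) auto
  then show "int (max_edges_ambiguous n k) = int (ex_complete n (k + 1)) - int (max 1 (n div k))"
    using e by simp
next
  fix G :: "'v graph"
  assume G: "simple_graph G \<and> card (verts G) = n"
  have k: "0 < k" using assms(2) by simp
  show "ambiguously_colorable k G \<and>
          int (card (edges G)) = int (ex_complete n (k + 1)) - int (max 1 (n div k))
        \<longleftrightarrow>
        (\<exists>A \<in> carrier_mat k k. desirable A \<and>
           (tiny A \<or> small A \<or> very_special A \<or> mininormal A) \<and>
           sum_mat A = n \<and> graph_iso G (matrix_graph A))"
    unfolding card_edges_eq_iff(1)[OF conjunct1[OF G] conjunct2[OF G] k]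
    using ambiguous_optimal_iff[OF conjunct1[OF G] assms(2)] conjunct2[OF G] by simp
qed

end
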